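(* Fix $s\in\{2,3,\dots\}\cup\{\infty\}$ and let $H_n^s$ be equipped with its Haar measure, with coordinate functions $v=(v_{ij})_{i,j=1}^n$. For a string $\varepsilon=(e_1,\dots,e_m)$ of symbols in $\{1,*\}$ put $\mathrm{Tr}_n(\varepsilon):=\mathrm{Tr}(v^{e_1}\cdots v^{e_m})=\sum_{i_1,\dots,i_m}v^{e_1}_{i_1i_2}v^{e_2}_{i_2i_3}\cdots v^{e_m}_{i_mi_1}$. Let $r\in\mathbb N$, $k_1,\dots,k_r\in\mathbb N$, $k=\sum k_i$, let $\gamma\in S_k$ be the trace permutation associated to $k_1,\dots,k_r$, and let $\varepsilon_1,\dots,\varepsilon_r$ be strings of lengths $k_1,\dots,k_r$. Then, as $n\to\infty$, the joint moments of the variables $\mathrm{Tr}_n(\varepsilon)$ converge, and for the limiting variables $v(\varepsilon)=\lim_{n\to\infty}\mathrm{Tr}_n(\varepsilon)$ the classical cumulants are $$c_r(v(\varepsilon_1),\dots,v(\varepsilon_r))=\#\{p\in P^s(\varepsilon_1\cdots\varepsilon_r) : p\vee\gamma=1_k,\ p=\gamma(p)\},$$ where $\varepsilon_1\cdots\varepsilon_r$ is the concatenation of the strings.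
   Context: $H_n^s=\mathbb Z_s\wr S_n$ is the group of $n\times n$ monomial matrices whose nonzero entries are $s$-th roots of unity; for $s=\infty$, the nonzero entries are arbitrary complex numbers of modulus $1$. $v^1_{ij}=v_{ij}$ and $v^*_{ij}=\overline{v_{ij}}$ (entrywise complex conjugate). For a string $\varepsilon=(e_1,\dots,e_k)$, $P^s(\varepsilon)$ is the set of partitions of $\{1,\dots,k\}$ such that in each block the number of positions $j$ with $e_j=1$ equals the number of positions with $e_j=*$ modulo $s$ (for $s=\infty$: exactly equal). The trace permutation $\gamma$ has cycles $(1,\dots,k_1)$, $(k_1+1,\dots,k_1+k_2)$, $\dots$, $(k-k_r+1,\dots,k)$; it is also viewed as the partition into its cycles; $\gamma(p)$ is the partition with blocks $\gamma(B)$, $B\in p$; $1_k$ is the one-block partition; $\vee$ is the join. Classical cumulants $c_r$ are the multilinear functionals defined by the moment-cumulant formula over all partitions. *)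

theory Defs
  imports "HOL-Probability.Probability" "HOL-Library.Disjoint_Sets" "HOL-Combinatorics.Permutations"
begin

datatype sym = One | Star

definition ent :: "sym \<Rightarrow> (nat \<Rightarrow> nat \<Rightarrow> complex) \<Rightarrow> nat \<Rightarrow> nat \<Rightarrow> complex" where
  "ent e V i j = (case e of One \<Rightarrow> V i j | Star \<Rightarrow> cnj (V i j))"

definition trace_str :: "nat \<Rightarrow> (nat \<Rightarrow> nat \<Rightarrow> complex) \<Rightarrow> sym list \<Rightarrow> complex" where
  "trace_str n V \<epsilon> =
     (\<Sum>i \<in> {0..<length \<epsilon>} \<rightarrow>\<^sub>E {0..<n}.
        \<Prod>l<length \<epsilon>. ent (\<epsilon> ! l) V (i l) (i (Suc l mod length \<epsilon>)))"

definition monomial_mat :: "nat \<Rightarrow> (nat \<Rightarrow> nat) \<Rightarrow> (nat \<Rightarrow> complex) \<Rightarrow> nat \<Rightarrow> nat \<Rightarrow> complex" where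
  "monomial_mat n \<sigma> z = (\<lambda>i j. if i < n \<and> j < n \<and> j = \<sigma> i then z i else 0)"

text \<open>The finite group H_n^s = Z_s wr S_n (s finite) as a set of monomial matrices.\<close>
definition H_fin :: "nat \<Rightarrow> nat \<Rightarrow> (nat \<Rightarrow> nat \<Rightarrow> complex) set" where
  "H_fin s n = {monomial_mat n \<sigma> z | \<sigma> z.
       \<sigma> permutes {0..<n} \<and> (\<forall>i<n. z i ^ s = 1)}"

text \<open>Expectation with respect to the Haar (probability) measure of H_n^s.
  For finite s the group is finite and Haar measure is the uniform measure.
  For s = infinity, H_n = T^n semidirect S_n, whose Haar measure is the product of the uniform
  measure on S_n and the normalised Lebesgue measure on the torus T^n
  (parametrised by angles in [0, 2 pi]).\<close>
definition haar_exp :: "enat \<Rightarrow> nat \<Rightarrow> ((nat \<Rightarrow> nat \<Rightarrow> complex) \<Rightarrow> complex) \<Rightarrow> complex" where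
  "haar_exp s n f =
     (case s of
        enat m \<Rightarrow> (\<Sum>V\<in>H_fin m n. f V) / of_nat (card (H_fin m n))
      | \<infinity> \<Rightarrow> (\<Sum>\<sigma> | \<sigma> permutes {0..<n}.
                 integral\<^sup>L (PiM {0..<n} (\<lambda>_. uniform_measure lborel {0..2*pi}))
                   (\<lambda>\<theta>. f (monomial_mat n \<sigma> (\<lambda>i. cis (\<theta> i))))) / of_nat (fact n))"

definition moment :: "enat \<Rightarrow> nat \<Rightarrow> sym list list \<Rightarrow> complex" where
  "moment s n xs = haar_exp s n (\<lambda>V. \<Prod>j<length xs. trace_str n V (xs ! j))"

text \<open>Classical cumulant defined from a moment functional M (on lists of variables)
  by the Moebius inversion of the moment-cumulant formula over all set partitions.\<close>
definition cumulant :: "('a list \<Rightarrow> complex) \<Rightarrow> 'a list \<Rightarrow> complex" where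
  "cumulant M xs =
     (\<Sum>\<pi> | partition_on {0..<length xs} \<pi>.
        (-1) ^ (card \<pi> - 1) * of_nat (fact (card \<pi> - 1)) * (\<Prod>B\<in>\<pi>. M (nths xs B)))"

definition balanced_block :: "enat \<Rightarrow> sym list \<Rightarrow> nat set \<Rightarrow> bool" where
  "balanced_block s \<epsilon> B =
     (case s of
        enat m \<Rightarrow> card {j\<in>B. \<epsilon> ! j = One} mod m = card {j\<in>B. \<epsilon> ! j = Star} mod m
      | \<infinity> \<Rightarrow> card {j\<in>B. \<epsilon> ! j = One} = card {j\<in>B. \<epsilon> ! j = Star})"

definition P_s :: "enat \<Rightarrow> sym list \<Rightarrow> nat set set set" where
  "P_s s \<epsilon> = {p. partition_on {0..<length \<epsilon>} p \<and> (\<forall>B\<in>p. balanced_block s \<epsilon> B)}"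

text \<open>Trace permutation gamma for block lengths ks = [k_1,...,k_r] on {0..<k}:
  cycles (o_l, o_l+1, ..., o_l + k_l - 1) with o_l = k_1 + ... + k_{l-1} (0-based).\<close>
definition blk :: "nat list \<Rightarrow> nat \<Rightarrow> nat" where
  "blk ks p = (LEAST l. p < sum_list (take (Suc l) ks))"

definition trace_perm :: "nat list \<Rightarrow> nat \<Rightarrow> nat" where
  "trace_perm ks p =
     (let l = blk ks p; a = sum_list (take l ks); b = sum_list (take (Suc l) ks)
      in if Suc p < b then Suc p else a)"

text \<open>gamma viewed as the partition into its cycles.\<close>
definition trace_part :: "nat list \<Rightarrow> nat set set" where
  "trace_part ks = {{sum_list (take l ks)..<sum_list (take (Suc l) ks)} | l. l < length ks}"

definition part_rel :: "'a set set \<Rightarrow> ('a \<times> 'a) set" where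
  "part_rel p = {(x, y). \<exists>B\<in>p. x \<in> B \<and> y \<in> B}"

definition join_part :: "'a set \<Rightarrow> 'a set set \<Rightarrow> 'a set set \<Rightarrow> 'a set set" where
  "join_part A p q = A // ((part_rel p \<union> part_rel q)\<^sup>+)"

end

theory Submission
  imports Defs
begin

text \<open>
  A monomial matrix \<open>v\<close> has \<open>v\<^sub>i\<^sub>j = z\<^sub>i\<close> if \<open>j = \<sigma> i\<close> and \<open>0\<close> otherwise, so a product of traces is a sum over
  index functions \<open>i\<close> with \<open>i \<circ> \<gamma> = \<sigma> \<circ> i\<close>. Averaging over the phases \<open>z\<close> keeps exactly the \<open>i\<close> whose
  kernel lies in \<open>P\<^sup>s\<close>, and averaging over \<open>\<sigma>\<close> gives total weight \<open>1\<close> to every \<open>\<gamma>\<close>-invariant kernel with at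
  most \<open>n\<close> blocks. Hence for \<open>n \<ge> k\<close> the moment is exactly the number of \<open>\<gamma>\<close>-invariant partitions in
  \<open>P\<^sup>s\<close>. In the cumulant, the product over the blocks of \<open>\<pi>\<close> counts the invariant \<open>p\<close> with \<open>p \<or> \<gamma>\<close> below \<open>\<pi>\<close>, so
  after exchanging the sums each \<open>p\<close> is weighted by a sum of the Moebius coefficients over all \<open>\<pi>\<close> above
  \<open>p \<or> \<gamma>\<close>, which is \<open>1\<close> if \<open>p \<or> \<gamma>\<close> has one block and \<open>0\<close> otherwise.
\<close>

section \<open>Moebius coefficients of set partitions\<close>

text \<open>The members of \<open>H\<close> act as hyperedges. For a nonempty \<open>A\<close> that
  contains all of them, these are the partitions above the partition of \<open>A\<close> into
  connected components, which thus never has to be constructed.\<close>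

definition compatible_partitions :: "'a set set \<Rightarrow> 'a set \<Rightarrow> 'a set set set" where
  "compatible_partitions H A = {\<pi>. partition_on A \<pi> \<and> (\<forall>E\<in>H. \<exists>B\<in>\<pi>. E \<subseteq> B)}"

text \<open>No hyperedge crosses the boundary of \<open>T\<close>, so within the vertex set
  \<open>T\<close> is a union of connected components.\<close>

definition separated :: "'a set set \<Rightarrow> 'a set \<Rightarrow> bool" where
  "separated H T \<longleftrightarrow> (\<forall>E\<in>H. E \<subseteq> T \<or> E \<inter> T = {})"

text \<open>For a nonempty \<open>\<pi>\<close> this is the Moebius function of the partition
  lattice on the interval from \<open>\<pi>\<close> to the one-block partition, as it occurs in
  \<open>cumulant\<close>.\<close>

definition part_moebius :: "'a set set \<Rightarrow> complex" where
  "part_moebius \<pi> = (-1) ^ (card \<pi> - 1) * of_nat (fact (card \<pi> - 1))"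

lemma partition_on_block_unique:
  assumes "partition_on A \<pi>" "B \<in> \<pi>" "C \<in> \<pi>" "x \<in> B" "x \<in> C"
  shows "B = C"
  using assms unfolding partition_on_def disjoint_def by blast

text \<open>With \<open>Suc m\<close> blocks in \<open>\<pi>\<close>, the separate block
  \<open>T\<close> has weight \<open>(-1) ^ Suc m * fact (Suc m)\<close>, while each of the
  \<open>Suc m\<close> ways to join \<open>T\<close> to a block keeps the number of blocks and has
  weight \<open>(-1) ^ m * fact m\<close>. The last two hypotheses make these block counts
  exact.\<close>

lemma part_moebius_insert:
  assumes "finite \<pi>" "\<pi> \<noteq> {}" "T \<notin> \<pi>"
    and "\<And>D. D \<in> \<pi> \<Longrightarrow> D \<union> T \<notin> \<pi>"
  shows "part_moebius (insert T \<pi>) + (\<Sum>D\<in>\<pi>. part_moebius (insert (D \<union> T) (\<pi> - {D}))) = 0"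
proof -
  obtain m where m: "card \<pi> = Suc m"
    using assms(1,2) by (metis card_0_eq not0_implies_Suc)
  have "card (insert (D \<union> T) (\<pi> - {D})) = card \<pi>" if "D \<in> \<pi>" for D
    using that assms by (simp add: card_Diff_singleton m)
  then have "(\<Sum>D\<in>\<pi>. part_moebius (insert (D \<union> T) (\<pi> - {D}))) = of_nat (card \<pi>) * part_moebius \<pi>"
    by (simp add: part_moebius_def)
  moreover have "card (insert T \<pi>) = Suc (card \<pi>)"
    using assms by simp
  ultimately show ?thesis
    by (simp add: part_moebius_def m algebra_simps)
qed

text \<open>Removing \<open>T\<close> maps the compatible partitions onto those of \<open>A - T\<close>; the fibre over \<open>\<pi>\<close> consists of
  \<open>T\<close> as a separate block and \<open>T\<close> joined to each of the blocks of \<open>\<pi>\<close>, and its weights cancel.\<close>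

lemma sum_part_moebius_separated:
  assumes fin: "finite A" and T: "T \<subseteq> A" "T \<noteq> {}" "T \<noteq> A" and sep: "separated H T"
    and keep: "\<And>\<pi>. \<pi> \<in> compatible_partitions H A \<Longrightarrow> \<exists>B\<in>\<pi>. T \<subseteq> B"
  shows "(\<Sum>\<pi>\<in>compatible_partitions H A. part_moebius \<pi>) = 0"
proof -
  define C where "C = compatible_partitions H A"
  define C' where "C' = compatible_partitions {E\<in>H. E \<inter> T = {}} (A - T)"
  \<comment> \<open>The block exists by \<open>keep\<close> and is unique because \<open>T\<close>
    is nonempty.\<close>
  define block where "block = (\<lambda>\<pi>. THE B. B \<in> \<pi> \<and> T \<subseteq> B)"
  have finC: "finite C" "finite C'"
    unfolding C_def C'_def compatible_partitions_def
    by (rule finite_subset[OF _ finitely_many_partition_on[of A]], use fin in auto)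
       (rule finite_subset[OF _ finitely_many_partition_on[of "A - T"]], use fin in auto)
  have block: "block \<pi> \<in> \<pi>" "T \<subseteq> block \<pi>" "\<And>B. B \<in> \<pi> \<Longrightarrow> B \<inter> T \<noteq> {} \<Longrightarrow> B = block \<pi>" if piC: "\<pi> \<in> C" for \<pi>
  proof -
    have p: "partition_on A \<pi>" using that by (auto simp: C_def compatible_partitions_def)
    obtain B where B: "B \<in> \<pi>" "T \<subseteq> B" using keep[of \<pi>] piC C_def by blast
    have "B' = B" if "B' \<in> \<pi>" "B' \<inter> T \<noteq> {}" for B'
      using partition_on_block_unique[OF p] B that by blast
    moreover from this have "block \<pi> = B"
      unfolding block_def using B T by (intro the_equality) blast+
    ultimately show "block \<pi> \<in> \<pi>" "T \<subseteq> block \<pi>" "\<And>B. B \<in> \<pi> \<Longrightarrow> B \<inter> T \<noteq> {} \<Longrightarrow> B = block \<pi>"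
      using B by auto
  qed
  \<comment> \<open>Here \<open>T \<noteq> A\<close> makes \<open>\<pi>\<close> nonempty, which the
    cancellation over its blocks requires.\<close>
  have C'D: "finite \<pi>" "\<pi> \<noteq> {}" "\<And>D. D \<in> \<pi> \<Longrightarrow> D \<inter> T = {} \<and> D \<noteq> {}" "\<Union>\<pi> = A - T" if "\<pi> \<in> C'" for \<pi>
    using that finite_elements[of "A - T" \<pi>] fin T
    by (auto simp: C'_def compatible_partitions_def partition_on_def)
  have 1: "(\<Sum>\<pi>\<in>{\<pi>\<in>C. T \<in> \<pi>}. part_moebius \<pi>) = (\<Sum>\<pi>\<in>C'. part_moebius (insert T \<pi>))"
  proof (rule sum.reindex_bij_witness[of _ "insert T" "\<lambda>\<pi>. \<pi> - {T}"], goal_cases)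
    case (1 \<pi>) then show ?case by auto
  next
    case (2 \<pi>)
    then have p: "partition_on A \<pi>" by (auto simp: C_def compatible_partitions_def)
    have "disjnt T (\<Union>(\<pi> - {T}))"
      using partition_on_block_unique[OF p] 2 unfolding disjnt_def by blast
    then have "partition_on (A - T) (\<pi> - {T})"
      using partition_on_insert[of T "\<pi> - {T}" A] 2 p by (simp add: insert_absorb)
    moreover have "\<exists>B\<in>\<pi> - {T}. E \<subseteq> B" if E: "E \<in> H" "E \<inter> T = {}" for E
    \<comment> \<open>The empty edge only asks that some block exists, and \<open>A - T\<close> is
      nonempty.\<close>
    proof (cases "E = {}")
      case True
      have "\<pi> - {T} \<noteq> {}" using calculation T by (auto simp: partition_on_def)
      then show ?thesis using True by auto
    next
      case False
      then show ?thesis using E 2 unfolding C_def compatible_partitions_def by blast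
    qed
    ultimately show ?case by (auto simp: C'_def compatible_partitions_def)
  next
    case (3 \<pi>)
    then show ?case using C'D(3)[of \<pi> T] T by auto
  next
    case (4 \<pi>)
    have "disjnt T (\<Union>\<pi>)" using C'D[OF 4] by (auto simp: disjnt_def)
    then have "partition_on A (insert T \<pi>)"
      using partition_on_insert[of T \<pi> A] 4 T by (auto simp: C'_def compatible_partitions_def)
    moreover have "\<exists>B\<in>insert T \<pi>. E \<subseteq> B" if "E \<in> H" for E
      using that sep 4 unfolding separated_def C'_def compatible_partitions_def by blast
    ultimately show ?case by (auto simp: C_def compatible_partitions_def)
  next
    case (5 \<pi>) then show ?case by (simp add: insert_absorb)
  qed
  have joinC: "insert (D \<union> T) (\<pi> - {D}) \<in> C \<and> T \<notin> insert (D \<union> T) (\<pi> - {D})"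
    if pD: "\<pi> \<in> C'" "D \<in> \<pi>" for \<pi> D
  proof -
    note c = C'D[OF pD(1)]
    have p: "partition_on (A - T) \<pi>" using pD by (auto simp: C'_def compatible_partitions_def)
    have un: "\<Union>(\<pi> - {D}) = A - T - D"
      using partition_on_block_unique[OF p] p pD(2) unfolding partition_on_def by blast
    then have "partition_on (A - (D \<union> T)) (\<pi> - {D})"
      using p by (auto simp: partition_on_def intro: pairwise_subset)
    moreover have "disjnt (D \<union> T) (\<Union>(\<pi> - {D}))" using un by (auto simp: disjnt_def)
    moreover have "D \<union> T \<subseteq> A" using p pD(2) T by (auto simp: partition_on_def)
    ultimately have "partition_on A (insert (D \<union> T) (\<pi> - {D}))"
      using T by (simp add: partition_on_insert)
    moreover have "\<exists>B\<in>insert (D \<union> T) (\<pi> - {D}). E \<subseteq> B" if E: "E \<in> H" for E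
    proof (cases "E \<subseteq> T")
      case False
      then obtain B where "B \<in> \<pi>" "E \<subseteq> B"
        using sep E pD(1) unfolding separated_def C'_def compatible_partitions_def by blast
      then show ?thesis by (cases "B = D") auto
    qed auto
    moreover have "T \<notin> insert (D \<union> T) (\<pi> - {D})" using c(3)[OF pD(2)] c(3)[of T] T by auto
    ultimately show ?thesis by (auto simp: C_def compatible_partitions_def)
  qed
  \<comment> \<open>If \<open>T\<close> is not a block, it lies strictly inside
    \<open>block \<pi>\<close>; cutting it out leaves a member of \<open>C'\<close> together with
    the block \<open>D\<close> to which \<open>T\<close> was joined.\<close>
  have 2: "(\<Sum>\<pi>\<in>{\<pi>\<in>C. T \<notin> \<pi>}. part_moebius \<pi>)
     = (\<Sum>(\<pi>,D)\<in>Sigma C' (\<lambda>\<pi>. \<pi>). part_moebius (insert (D \<union> T) (\<pi> - {D})))"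
  proof (rule sum.reindex_bij_witness[of _ "\<lambda>(\<pi>,D). insert (D \<union> T) (\<pi> - {D})"
        "\<lambda>\<pi>. (insert (block \<pi> - T) (\<pi> - {block \<pi>}), block \<pi> - T)"], goal_cases)
    case (1 \<pi>)
    then have pC: "\<pi> \<in> C" by simp
    then have p: "partition_on A \<pi>" by (auto simp: C_def compatible_partitions_def)
    note b = block[OF pC]
    have ne: "block \<pi> - T \<noteq> {}" using b(1,2) 1 by auto
    \<comment> \<open>A nonempty proper part of a block is not a block, so inserting it and removing
      it again changes nothing.\<close>
    have "block \<pi> - T \<notin> \<pi>"
      using partition_on_block_unique[OF p b(1)] ne b(2) T by blast
    then have "insert (block \<pi> - T) (\<pi> - {block \<pi>}) - {block \<pi> - T} = \<pi> - {block \<pi>}" by auto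
    moreover have "block \<pi> - T \<union> T = block \<pi>" using b(1,2) by auto
    ultimately show ?case using b(1) by (simp add: insert_absorb)
  next
    case (2 \<pi>)
    then have pC: "\<pi> \<in> C" by simp
    then have p: "partition_on A \<pi>" by (auto simp: C_def compatible_partitions_def)
    note b = block[OF pC]
    have ne: "block \<pi> - T \<noteq> {}" using b(1,2) 2 by auto
    have dj: "B \<inter> block \<pi> = {}" if "B \<in> \<pi> - {block \<pi>}" for B
      using partition_on_block_unique[OF p b(1)] that by blast
    have un: "\<Union>(\<pi> - {block \<pi>}) = A - block \<pi>"
      using dj p b(1) unfolding partition_on_def by blast
    have "A - T - (block \<pi> - T) = A - block \<pi>" using b(1,2) by auto
    moreover have "partition_on (A - block \<pi>) (\<pi> - {block \<pi>})"
      using un p by (auto simp: partition_on_def intro: pairwise_subset)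
    moreover have "disjnt (block \<pi> - T) (\<Union>(\<pi> - {block \<pi>}))" using un by (auto simp: disjnt_def)
    moreover have "block \<pi> - T \<subseteq> A - T" using p b(1) by (auto simp: partition_on_def)
    ultimately have "partition_on (A - T) (insert (block \<pi> - T) (\<pi> - {block \<pi>}))"
      using ne by (simp add: partition_on_insert)
    moreover have "\<exists>B\<in>insert (block \<pi> - T) (\<pi> - {block \<pi>}). E \<subseteq> B" if E: "E \<in> H" "E \<inter> T = {}" for E
    proof -
      obtain B where "B \<in> \<pi>" "E \<subseteq> B" using pC E by (auto simp: C_def compatible_partitions_def)
      then show ?thesis using E(2) by (cases "B = block \<pi>") auto
    qed
    ultimately show ?case by (auto simp: C'_def compatible_partitions_def)
  next
    case (3 x)
    obtain \<pi> D where x: "x = (\<pi>, D)" and pD: "\<pi> \<in> C'" "D \<in> \<pi>" using 3 by auto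
    note c = C'D[OF pD(1)]
    let ?q = "insert (D \<union> T) (\<pi> - {D})"
    have q: "?q \<in> C" using joinC[OF pD] by simp
    have "block ?q = D \<union> T"
      using block(3)[OF q, of "D \<union> T"] T by auto
    moreover have "D \<union> T \<notin> \<pi>" using c(3) T by blast
    moreover have "D \<union> T - T = D" using c(3)[OF pD(2)] by auto
    ultimately show ?case using pD unfolding x by auto
  next
    case (4 x)
    obtain \<pi> D where x: "x = (\<pi>, D)" and pD: "\<pi> \<in> C'" "D \<in> \<pi>" using 4 by auto
    show ?case using joinC[OF pD] by (simp add: x)
  next
    case (5 \<pi>)
    then have pC: "\<pi> \<in> C" by simp
    then have p: "partition_on A \<pi>" by (auto simp: C_def compatible_partitions_def)
    note b = block[OF pC]
    have ne: "block \<pi> - T \<noteq> {}" using b(1,2) 5 by auto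
    have "block \<pi> - T \<notin> \<pi>"
      using partition_on_block_unique[OF p b(1)] ne b(2) T by blast
    then have "insert (block \<pi> - T) (\<pi> - {block \<pi>}) - {block \<pi> - T} = \<pi> - {block \<pi>}" by auto
    moreover have "block \<pi> - T \<union> T = block \<pi>" using b(1,2) by auto
    ultimately show ?case using b(1) by (simp add: insert_absorb)
  qed
  have "(\<Sum>\<pi>\<in>C. part_moebius \<pi>)
      = (\<Sum>\<pi>\<in>{\<pi>\<in>C. T \<in> \<pi>}. part_moebius \<pi>) + (\<Sum>\<pi>\<in>{\<pi>\<in>C. T \<notin> \<pi>}. part_moebius \<pi>)"
    using finC by (subst sum.union_disjoint[symmetric]) (auto intro: sum.cong)
  also have "\<dots> = (\<Sum>\<pi>\<in>C'. part_moebius (insert T \<pi>) + (\<Sum>D\<in>\<pi>. part_moebius (insert (D \<union> T) (\<pi> - {D}))))"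
    unfolding 1 2 using finC C'D(1) by (subst sum.Sigma[symmetric]) (auto simp: sum.distrib)
  also have "\<dots> = 0"
    using C'D T by (intro sum.neutral ballI part_moebius_insert) blast+
  finally show ?thesis by (simp add: C_def)
qed

text \<open>If the hypergraph is connected, only \<open>{A}\<close> is compatible. Otherwise a
  minimal proper separated set lies within one block of every compatible partition, and the
  cancellation for such a set applies.\<close>

lemma sum_part_moebius_compatible:
  assumes fin: "finite A" and ne: "A \<noteq> {}" and H: "\<And>E. E \<in> H \<Longrightarrow> E \<subseteq> A"
  shows "(\<Sum>\<pi>\<in>compatible_partitions H A. part_moebius \<pi>)
    = (if \<forall>T\<subseteq>A. T \<noteq> {} \<longrightarrow> separated H T \<longrightarrow> T = A then 1 else 0)"
proof -
  have blocks: "separated H B" if "\<pi> \<in> compatible_partitions H A" "B \<in> \<pi>" for \<pi> B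
    using that partition_on_block_unique[of A \<pi>]
    unfolding separated_def compatible_partitions_def by blast
  show ?thesis
  proof (cases "\<forall>T\<subseteq>A. T \<noteq> {} \<longrightarrow> separated H T \<longrightarrow> T = A")
    case True
    have "\<pi> = {A}" if "\<pi> \<in> compatible_partitions H A" for \<pi>
    proof -
      have p: "partition_on A \<pi>" using that by (simp add: compatible_partitions_def)
      then have "B = A" if "B \<in> \<pi>" for B
        using True blocks[OF \<open>\<pi> \<in> _\<close> that] that by (auto simp: partition_on_def)
      then show ?thesis using p ne by (auto simp: partition_on_def)
    qed
    moreover have "{A} \<in> compatible_partitions H A"
      using ne H by (auto simp: compatible_partitions_def partition_on_space)
    ultimately have "compatible_partitions H A = {{A}}" by blast
    then show ?thesis using True by (auto simp: part_moebius_def)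
  next
    case False
    define S where "S = {T. T \<subseteq> A \<and> T \<noteq> {} \<and> T \<noteq> A \<and> separated H T}"
    have "finite S" "S \<noteq> {}" using fin False by (auto simp: S_def)
    then obtain T where T: "T \<in> S" "\<And>T'. T' \<in> S \<Longrightarrow> T' \<subseteq> T \<Longrightarrow> T' = T"
      by (metis finite_has_minimal)
    have "\<exists>B\<in>\<pi>. T \<subseteq> B" if pi: "\<pi> \<in> compatible_partitions H A" for \<pi>
    proof -
      obtain B where B: "B \<in> \<pi>" "T \<inter> B \<noteq> {}"
        using pi T(1) unfolding S_def compatible_partitions_def partition_on_def by blast
      \<comment> \<open>Blocks of compatible partitions are separated, and separated sets are closed
        under intersection; minimality of \<open>T\<close> then gives
        \<open>T \<inter> B = T\<close>.\<close>
      have "separated H (T \<inter> B)"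
        using blocks[OF pi B(1)] T(1) unfolding S_def separated_def by blast
      then have "T \<inter> B \<in> S" using T(1) B by (auto simp: S_def)
      then show ?thesis using T(2)[of "T \<inter> B"] B(1) by auto
    qed
    then have "(\<Sum>\<pi>\<in>compatible_partitions H A. part_moebius \<pi>) = 0"
      using T(1) fin by (intro sum_part_moebius_separated[of A T]) (auto simp: S_def)
    then show ?thesis using False by simp
  qed
qed

section \<open>Kernels of index functions\<close>

text \<open>Only attained values are used, so no empty level set appears and the result is a
  partition for every \<open>i\<close>.\<close>

definition kernel_part :: "'a set \<Rightarrow> ('a \<Rightarrow> 'b) \<Rightarrow> 'a set set" where
  "kernel_part U i = (\<lambda>a. {x\<in>U. i x = a}) ` i ` U"

text \<open>Invariance is stated blockwise, so that it restricts to invariant subsets of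
  \<open>U\<close>; \<open>image_blocks_eq_iff\<close> recovers the equation between
  \<open>p\<close> and its image.\<close>

definition invariant_partitions :: "('a set \<Rightarrow> bool) \<Rightarrow> ('a \<Rightarrow> 'a) \<Rightarrow> 'a set \<Rightarrow> 'a set set set" where
  "invariant_partitions bal g U = {p. partition_on U p \<and> (\<forall>X\<in>p. bal X \<and> g ` X \<in> p)}"

lemma partition_on_kernel_part: "partition_on U (kernel_part U i)"
  by (auto simp: kernel_part_def partition_on_def disjoint_def)

lemma kernel_part_same_block_iff:
  assumes "x \<in> U" "y \<in> U"
  shows "(\<exists>B\<in>kernel_part U i. x \<in> B \<and> y \<in> B) \<longleftrightarrow> i x = i y"
  using assms by (auto simp: kernel_part_def)

lemma kernel_part_eqI:
  assumes p: "partition_on U p"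
    and same: "\<And>x y. x \<in> U \<Longrightarrow> y \<in> U \<Longrightarrow> i x = i y \<longleftrightarrow> (\<exists>B\<in>p. x \<in> B \<and> y \<in> B)"
  shows "kernel_part U i = p"
proof -
  have *: "{y\<in>U. i y = i x} = B" if "B \<in> p" "x \<in> B" for x B
  proof -
    have "B \<subseteq> U" using p that by (auto simp: partition_on_def)
    then show ?thesis
      using that same[of _ x] partition_on_block_unique[OF p _ that(1) _ that(2)] by blast
  qed
  show ?thesis
  proof (intro equalityI subsetI)
    fix X assume "X \<in> kernel_part U i"
    then obtain x where x: "x \<in> U" "X = {y\<in>U. i y = i x}" by (auto simp: kernel_part_def)
    then obtain B where "B \<in> p" "x \<in> B" using p by (auto simp: partition_on_def)
    then show "X \<in> p" using * x by simp
  next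
    fix B assume B: "B \<in> p"
    then have "B \<noteq> {}" "B \<subseteq> U" using p by (auto simp: partition_on_def)
    then obtain x where x: "x \<in> B" "x \<in> U" by blast
    then show "B \<in> kernel_part U i" using *[OF B x(1)] by (auto simp: kernel_part_def)
  qed
qed

lemma kernel_part_eqD:
  assumes "kernel_part U i = kernel_part U j" "x \<in> U" "y \<in> U"
  shows "i x = i y \<longleftrightarrow> j x = j y"
  using kernel_part_same_block_iff[OF assms(2,3), of i] kernel_part_same_block_iff[OF assms(2,3), of j]
    assms(1) by simp

text \<open>Equal kernels make the assignment of \<open>j x\<close> to \<open>i x\<close> a
  well-defined bijection between the images. The complements of the images in the finite set
  \<open>N\<close> have equal size, so it extends to all of \<open>N\<close>.\<close>

lemma exists_permutation_same_kernel:
  assumes N: "finite N" and i: "i ` U \<subseteq> N" and j: "j ` U \<subseteq> N"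
    and ker: "kernel_part U i = kernel_part U j"
  shows "\<exists>\<sigma>. \<sigma> permutes N \<and> (\<forall>x\<in>U. \<sigma> (i x) = j x)"
proof -
  define f where "f = (\<lambda>a. j (SOME x. x \<in> U \<and> i x = a))"
  have f: "f (i x) = j x" if "x \<in> U" for x
  proof -
    have "(SOME y. y \<in> U \<and> i y = i x) \<in> U \<and> i (SOME y. y \<in> U \<and> i y = i x) = i x"
      by (rule someI[of _ x]) (use that in simp)
    then show ?thesis using kernel_part_eqD[OF ker] that by (auto simp: f_def)
  qed
  have bf: "bij_betw f (i ` U) (j ` U)"
    using f kernel_part_eqD[OF ker] by (auto simp: bij_betw_def inj_on_def image_image)
  have "card (N - i ` U) = card (N - j ` U)"
    using N i j bij_betw_same_card[OF bf] by (simp add: card_Diff_subset finite_subset)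
  then obtain h where bh: "bij_betw h (N - i ` U) (N - j ` U)"
    using N finite_same_card_bij[of "N - i ` U" "N - j ` U"] by auto
  define \<sigma> where "\<sigma> = (\<lambda>a. if a \<in> i ` U then f a else if a \<in> N then h a else a)"
  have "bij_betw \<sigma> (i ` U) (j ` U)" using bf by (auto simp: \<sigma>_def cong: bij_betw_cong)
  moreover have "bij_betw \<sigma> (N - i ` U) (N - j ` U)"
    using bh by (subst bij_betw_cong[of _ \<sigma> h]) (auto simp: \<sigma>_def)
  ultimately have "bij_betw \<sigma> (i ` U \<union> (N - i ` U)) (j ` U \<union> (N - j ` U))"
    by (rule bij_betw_combine) auto
  then have "bij_betw \<sigma> N N" using i j by (simp add: Un_absorb1)
  then have "\<sigma> permutes N" using i by (intro bij_imp_permutes) (auto simp: \<sigma>_def)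
  then show ?thesis using f by (auto simp: \<sigma>_def)
qed

text \<open>Left composition with a permutation that carries \<open>j\<close> to \<open>j'\<close>
  is a bijection between the two sets, so the count sees the target only through its kernel.\<close>

lemma card_permutations_same_kernel:
  assumes N: "finite N" and j: "j ` U \<subseteq> N" and j': "j' ` U \<subseteq> N"
    and ker: "kernel_part U j = kernel_part U j'"
  shows "card {\<sigma>. \<sigma> permutes N \<and> (\<forall>x\<in>U. \<sigma> (i x) = j x)}
    = card {\<sigma>. \<sigma> permutes N \<and> (\<forall>x\<in>U. \<sigma> (i x) = j' x)}"
proof -
  obtain \<tau> where \<tau>: "\<tau> permutes N" "\<And>x. x \<in> U \<Longrightarrow> \<tau> (j x) = j' x"
    using exists_permutation_same_kernel[OF N j j' ker] by blast
  have inv: "inv \<tau> (j' x) = j x" if "x \<in> U" for x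
    using \<tau> that by (metis permutes_inverses(2))
  have "bij_betw (\<lambda>\<sigma>. \<tau> \<circ> \<sigma>) {\<sigma>. \<sigma> permutes N \<and> (\<forall>x\<in>U. \<sigma> (i x) = j x)}
     {\<sigma>. \<sigma> permutes N \<and> (\<forall>x\<in>U. \<sigma> (i x) = j' x)}"
    by (rule bij_betw_byWitness[where f' = "\<lambda>\<sigma>. inv \<tau> \<circ> \<sigma>"])
      (use \<tau> inv in \<open>auto simp: permutes_compose permutes_inv permutes_inverses fun_eq_iff\<close>)
  then show ?thesis by (rule bij_betw_same_card)
qed

section \<open>Index functions with a prescribed kernel\<close>

definition with_kernel :: "'a set \<Rightarrow> 'b set \<Rightarrow> 'a set set \<Rightarrow> ('a \<Rightarrow> 'b) set" where
  "with_kernel U N p = {i \<in> U \<rightarrow>\<^sub>E N. kernel_part U i = p}"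

lemma card_partition_on_le:
  assumes U: "finite U" and p: "partition_on U p"
  shows "card p \<le> card U"
proof -
  have "p \<subseteq> (\<lambda>x. THE B. B \<in> p \<and> x \<in> B) ` U"
  proof
    fix B assume B: "B \<in> p"
    then have "B \<noteq> {}" "B \<subseteq> U" using p by (auto simp: partition_on_def)
    then obtain x where x: "x \<in> B" "x \<in> U" by blast
    have "(THE B. B \<in> p \<and> x \<in> B) = B"
      using B x partition_on_block_unique[OF p] by (intro the_equality) auto
    then show "B \<in> (\<lambda>x. THE B. B \<in> p \<and> x \<in> B) ` U" using x by force
  qed
  then show ?thesis using U by (meson card_image_le card_mono finite_imageI le_trans)
qed

text \<open>Label the blocks injectively by elements of \<open>N\<close> and send each point to the
  label of its block. The lower bound on \<open>n\<close> in the exact moment formula comes from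
  here.\<close>

lemma with_kernel_nonempty:
  assumes U: "finite U" and N: "finite N" and p: "partition_on U p" and le: "card p \<le> card N"
  shows "with_kernel U N p \<noteq> {}"
proof -
  have "finite p" using U p finite_elements by blast
  then obtain h where h: "h ` p \<subseteq> N" "inj_on h p"
    using N le by (meson card_le_inj)
  define b where "b = (\<lambda>x. THE B. B \<in> p \<and> x \<in> B)"
  have b: "b x = B" if "B \<in> p" "x \<in> B" for x B
    unfolding b_def using that partition_on_block_unique[OF p] by (intro the_equality) auto
  have bp: "b x \<in> p \<and> x \<in> b x" if xU: "x \<in> U" for x
  proof -
    obtain B where "B \<in> p" "x \<in> B" using xU p by (auto simp: partition_on_def)
    then show ?thesis using b by simp
  qed
  have "kernel_part U (\<lambda>x\<in>U. h (b x)) = p"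
  proof (rule kernel_part_eqI[OF p])
    fix x y assume xy: "x \<in> U" "y \<in> U"
    have "h (b x) = h (b y) \<longleftrightarrow> b x = b y"
      using bp[OF xy(1)] bp[OF xy(2)] h(2) by (simp add: inj_on_eq_iff)
    also have "\<dots> \<longleftrightarrow> (\<exists>B\<in>p. x \<in> B \<and> y \<in> B)"
      using bp[OF xy(1)] bp[OF xy(2)] b by metis
    finally show "(\<lambda>x\<in>U. h (b x)) x = (\<lambda>x\<in>U. h (b x)) y \<longleftrightarrow> (\<exists>B\<in>p. x \<in> B \<and> y \<in> B)"
      using xy by simp
  qed
  moreover have "(\<lambda>x\<in>U. h (b x)) \<in> U \<rightarrow>\<^sub>E N" using bp h(1) by auto
  ultimately show ?thesis unfolding with_kernel_def by blast
qed

text \<open>Permutations act transitively on the functions with a given kernel, so the number of \<open>\<sigma>\<close> carrying \<open>i\<close>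
  to \<open>f i\<close> does not depend on the target: replace \<open>f i\<close> by a fixed \<open>i0\<close> and count by \<open>\<sigma>\<close> instead.\<close>

lemma sum_card_permutations_with_kernel:
  assumes U: "finite U" and N: "finite N" and f: "\<And>i. i \<in> with_kernel U N p \<Longrightarrow> f i \<in> with_kernel U N p"
    and ne: "with_kernel U N p \<noteq> {}"
  shows "(\<Sum>i\<in>with_kernel U N p. card {\<sigma>. \<sigma> permutes N \<and> (\<forall>x\<in>U. \<sigma> (i x) = f i x)}) = fact (card N)"
proof -
  let ?X = "with_kernel U N p"
  let ?S = "{\<sigma>. \<sigma> permutes N}"
  have finX: "finite ?X" and finS: "finite ?S"
    using U N by (auto simp: with_kernel_def finite_PiE finite_permutations)
  obtain i0 where i0: "i0 \<in> ?X" using ne by blast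
  have img: "i ` U \<subseteq> N" if "i \<in> ?X" for i using that by (auto simp: with_kernel_def)
  \<comment> \<open>For fixed \<open>\<sigma>\<close>, the equation carrying \<open>i\<close> to
    \<open>i0\<close> has one solution on \<open>U\<close>, and it has the kernel of
    \<open>i0\<close> because \<open>inv \<sigma>\<close> is injective.\<close>
  have uniq: "{i\<in>?X. \<forall>x\<in>U. \<sigma> (i x) = i0 x} = {\<lambda>x\<in>U. inv \<sigma> (i0 x)}" if s: "\<sigma> permutes N" for \<sigma>
  proof -
    have "(\<lambda>x\<in>U. inv \<sigma> (i0 x)) \<in> U \<rightarrow>\<^sub>E N"
      using i0 permutes_in_image[OF permutes_inv[OF s]] by (auto simp: with_kernel_def)
    moreover have "kernel_part U (\<lambda>x\<in>U. inv \<sigma> (i0 x)) = p"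
    proof (rule kernel_part_eqI)
      show "partition_on U p" using i0 partition_on_kernel_part by (auto simp: with_kernel_def)
      show "(\<lambda>x\<in>U. inv \<sigma> (i0 x)) x = (\<lambda>x\<in>U. inv \<sigma> (i0 x)) y \<longleftrightarrow> (\<exists>B\<in>p. x \<in> B \<and> y \<in> B)"
        if "x \<in> U" "y \<in> U" for x y
        using that i0 kernel_part_same_block_iff[OF that, of i0] permutes_inj[OF permutes_inv[OF s]]
        by (auto simp: with_kernel_def inj_eq)
    qed
    ultimately have "(\<lambda>x\<in>U. inv \<sigma> (i0 x)) \<in> ?X" by (simp add: with_kernel_def)
    moreover have "i = (\<lambda>x\<in>U. inv \<sigma> (i0 x))" if "i \<in> ?X" "\<forall>x\<in>U. \<sigma> (i x) = i0 x" for i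
    proof
      fix x show "i x = (\<lambda>x\<in>U. inv \<sigma> (i0 x)) x"
        using that permutes_inverses(2)[OF s, of "i x"]
        by (cases "x \<in> U") (auto simp: with_kernel_def PiE_def extensional_def)
    qed
    moreover have "\<forall>x\<in>U. \<sigma> ((\<lambda>x\<in>U. inv \<sigma> (i0 x)) x) = i0 x"
      using permutes_inverses(1)[OF s] by auto
    ultimately show ?thesis by blast
  qed
  have "(\<Sum>i\<in>?X. card {\<sigma>. \<sigma> permutes N \<and> (\<forall>x\<in>U. \<sigma> (i x) = f i x)})
      = (\<Sum>i\<in>?X. card {\<sigma>\<in>?S. \<forall>x\<in>U. \<sigma> (i x) = i0 x})"
    using img f i0
    by (intro sum.cong refl, simp, intro card_permutations_same_kernel[OF N])
       (auto simp: with_kernel_def)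
  \<comment> \<open>Double counting of the pairs of \<open>i\<close> and \<open>\<sigma>\<close>;
    each \<open>\<sigma>\<close> then contributes exactly one \<open>i\<close>.\<close>
  also have "\<dots> = (\<Sum>\<sigma>\<in>?S. card {i\<in>?X. \<forall>x\<in>U. \<sigma> (i x) = i0 x})"
    by (rule sum_multicount_gen) (use finX finS in auto)
  also have "\<dots> = (\<Sum>\<sigma>\<in>?S. 1)"
    using uniq by (intro sum.cong) auto
  also have "\<dots> = fact (card N)" using N by (simp add: card_permutations)
  finally show ?thesis .
qed

text \<open>The intertwining relation sends the level set of a value \<open>a\<close> into that of
  \<open>\<sigma> a\<close>; injectivity of \<open>\<sigma>\<close> and surjectivity of
  \<open>g\<close> on \<open>U\<close> make this onto.\<close>

lemma kernel_part_intertwined: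
  assumes U: "g ` U = U" and inj: "inj \<sigma>" and i: "\<And>x. x \<in> U \<Longrightarrow> i (g x) = \<sigma> (i x)"
    and X: "X \<in> kernel_part U i"
  shows "g ` X \<in> kernel_part U i"
proof -
  obtain x where x: "x \<in> U" "X = {y\<in>U. i y = i x}" using X by (auto simp: kernel_part_def)
  have gU: "g y \<in> U" if "y \<in> U" for y using U that by blast
  have "g ` X = {y\<in>U. i y = i (g x)}"
  proof (intro equalityI subsetI)
    fix y assume "y \<in> {y\<in>U. i y = i (g x)}"
    then have y: "y \<in> g ` U" "i y = i (g x)" using U by simp_all
    then obtain z where z: "z \<in> U" "y = g z" by blast
    then have "i z = i x" using y(2) i[OF z(1)] i[OF x(1)] inj by (simp add: inj_eq)
    then show "y \<in> g ` X" using z x(2) by blast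
  next
    fix y assume "y \<in> g ` X"
    then obtain z where "z \<in> U" "i z = i x" "y = g z" using x(2) by blast
    then show "y \<in> {y\<in>U. i y = i (g x)}" using gU i[OF x(1)] i[of z] by simp
  qed
  then show ?thesis using gU[OF x(1)] by (auto simp: kernel_part_def)
qed

text \<open>Since \<open>g\<close> permutes points injectively and maps blocks to blocks,
  \<open>g x\<close> and \<open>g y\<close> share a block exactly when \<open>x\<close> and
  \<open>y\<close> do. Thus the shifted function is an admissible target for
  \<open>sum_card_permutations_with_kernel\<close>.\<close>

lemma kernel_part_compose_invariant:
  assumes bij: "bij_betw g U U" and p: "partition_on U p" and inv: "\<And>X. X \<in> p \<Longrightarrow> g ` X \<in> p"
    and i: "kernel_part U i = p"
  shows "kernel_part U (\<lambda>x\<in>U. i (g x)) = p"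
proof (rule kernel_part_eqI[OF p])
  fix x y assume xy: "x \<in> U" "y \<in> U"
  then have gU: "g x \<in> U" "g y \<in> U" using bij by (auto simp: bij_betw_def)
  obtain X Y where X: "X \<in> p" "x \<in> X" and Y: "Y \<in> p" "y \<in> Y"
    using xy p by (auto simp: partition_on_def)
  have sub: "X \<subseteq> U" "Y \<subseteq> U" using X Y p by (auto simp: partition_on_def)
  have "(\<exists>B\<in>p. g x \<in> B \<and> g y \<in> B) \<longleftrightarrow> g ` X = g ` Y"
  proof
    assume "\<exists>B\<in>p. g x \<in> B \<and> g y \<in> B"
    then obtain B where B: "B \<in> p" "g x \<in> B" "g y \<in> B" by blast
    then have "g ` X = B" "g ` Y = B"
      using partition_on_block_unique[OF p inv[OF X(1)] B(1) imageI[OF X(2)]]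
        partition_on_block_unique[OF p inv[OF Y(1)] B(1) imageI[OF Y(2)]] by simp_all
    then show "g ` X = g ` Y" by simp
  next
    assume "g ` X = g ` Y"
    then show "\<exists>B\<in>p. g x \<in> B \<and> g y \<in> B"
      using inv[OF X(1)] X(2) Y(2) by (intro bexI[of _ "g ` X"]) auto
  qed
  also have "\<dots> \<longleftrightarrow> X = Y"
    using sub bij by (auto simp: bij_betw_def inj_on_image_eq_iff)
  also have "\<dots> \<longleftrightarrow> (\<exists>B\<in>p. x \<in> B \<and> y \<in> B)"
    using partition_on_block_unique[OF p] X Y by blast
  finally show "(\<lambda>x\<in>U. i (g x)) x = (\<lambda>x\<in>U. i (g x)) y \<longleftrightarrow> (\<exists>B\<in>p. x \<in> B \<and> y \<in> B)"
    using kernel_part_same_block_iff[OF gU, of i] i xy by simp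
qed

text \<open>Group the index functions by kernel. A balanced invariant kernel contributes
  \<open>fact (card N)\<close> by transitivity of the permutations; any other contributes
  \<open>0\<close>, because an intertwining \<open>\<sigma>\<close> forces the kernel to be
  invariant.\<close>

lemma sum_card_intertwiners:
  assumes U: "finite U" and N: "finite N" and bij: "bij_betw g U U" and le: "card U \<le> card N"
    and bal: "bal {}"
  shows "(\<Sum>i\<in>U \<rightarrow>\<^sub>E N. if \<forall>a\<in>N. bal {x\<in>U. i x = a}
            then card {\<sigma>. \<sigma> permutes N \<and> (\<forall>x\<in>U. \<sigma> (i x) = i (g x))} else 0)
    = fact (card N) * card (invariant_partitions bal g U)"
    (is "sum ?h _ = _")
proof -
  let ?P = "{p. partition_on U p}"
  have gU: "g ` U = U" using bij by (simp add: bij_betw_def)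
  have finP: "finite ?P" using U by (rule finitely_many_partition_on)
  \<comment> \<open>Values that are not attained have an empty level set, accepted by
    \<open>bal {}\<close>, so balance depends on the kernel alone.\<close>
  have balanced: "(\<forall>a\<in>N. bal {x\<in>U. i x = a}) \<longleftrightarrow> (\<forall>X\<in>p. bal X)" if "i \<in> with_kernel U N p" for i p
  proof -
    have "bal {x\<in>U. i x = a}" if "\<forall>X\<in>kernel_part U i. bal X" for a
    proof (cases "a \<in> i ` U")
      case False
      then have "{x\<in>U. i x = a} = {}" by auto
      then show ?thesis using bal by (simp only:)
    qed (use that in \<open>auto simp: kernel_part_def\<close>)
    moreover have "i ` U \<subseteq> N" "p = kernel_part U i" using that by (auto simp: with_kernel_def)
    ultimately show ?thesis by (auto simp: kernel_part_def)
  qed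
  have inner: "sum ?h (with_kernel U N p) = (if p \<in> invariant_partitions bal g U then fact (card N) else 0)"
    if p: "partition_on U p" for p
  proof (cases "p \<in> invariant_partitions bal g U")
    case True
    then have inv: "\<And>X. X \<in> p \<Longrightarrow> bal X \<and> g ` X \<in> p" by (auto simp: invariant_partitions_def)
    have closed: "(\<lambda>x\<in>U. i (g x)) \<in> with_kernel U N p" if "i \<in> with_kernel U N p" for i
      using that kernel_part_compose_invariant[OF bij p, of i] inv gU
      by (auto simp: with_kernel_def)
    have "card p \<le> card U" using card_partition_on_le[OF U p] .
    then have "with_kernel U N p \<noteq> {}" using with_kernel_nonempty[OF U N p] le by simp
    then have "(\<Sum>i\<in>with_kernel U N p. card {\<sigma>. \<sigma> permutes N \<and> (\<forall>x\<in>U. \<sigma> (i x) = (\<lambda>x\<in>U. i (g x)) x)})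
       = fact (card N)"
      by (intro sum_card_permutations_with_kernel[OF U N closed])
    also have "(\<Sum>i\<in>with_kernel U N p. card {\<sigma>. \<sigma> permutes N \<and> (\<forall>x\<in>U. \<sigma> (i x) = (\<lambda>x\<in>U. i (g x)) x)})
       = sum ?h (with_kernel U N p)"
      using balanced inv by (intro sum.cong) auto
    finally show ?thesis using True by simp
  next
    case False
    have "?h i = 0" if i: "i \<in> with_kernel U N p" for i
    proof (rule ccontr)
      assume "?h i \<noteq> 0"
      then have b: "\<forall>a\<in>N. bal {x\<in>U. i x = a}"
        and c: "card {\<sigma>. \<sigma> permutes N \<and> (\<forall>x\<in>U. \<sigma> (i x) = i (g x))} \<noteq> 0"
        by (auto split: if_splits)
      from c obtain \<sigma> where \<sigma>: "\<sigma> permutes N" "\<forall>x\<in>U. \<sigma> (i x) = i (g x)"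
        by (metis (mono_tags, lifting) card.empty empty_Collect_eq)
      have "g ` X \<in> p" if "X \<in> p" for X
        using kernel_part_intertwined[OF gU permutes_inj[OF \<sigma>(1)], of i X] \<sigma>(2) i that
        by (auto simp: with_kernel_def)
      then have "p \<in> invariant_partitions bal g U"
        using b balanced[OF i] p by (auto simp: invariant_partitions_def)
      then show False using False by simp
    qed
    then show ?thesis using False by (simp add: sum.neutral)
  qed
  have "sum ?h (U \<rightarrow>\<^sub>E N) = (\<Sum>p\<in>?P. sum ?h {i\<in>U \<rightarrow>\<^sub>E N. kernel_part U i = p})"
    using U N finP partition_on_kernel_part by (intro sum.group[symmetric]) (auto simp: finite_PiE)
  also have "\<dots> = (\<Sum>p\<in>?P. if p \<in> invariant_partitions bal g U then fact (card N) else 0)"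
    using inner by (intro sum.cong) (auto simp: with_kernel_def)
  also have "\<dots> = fact (card N) * card (invariant_partitions bal g U)"
  proof -
    have "?P \<inter> invariant_partitions bal g U = invariant_partitions bal g U"
      by (auto simp: invariant_partitions_def)
    then show ?thesis using finP by (simp add: sum.inter_restrict[symmetric])
  qed
  finally show ?thesis .
qed

section \<open>Averages over the monomial group\<close>

definition phase :: "sym \<Rightarrow> complex \<Rightarrow> complex" where
  "phase e w = (case e of One \<Rightarrow> w | Star \<Rightarrow> cnj w)"

lemma prod_phase:
  assumes "finite B"
  shows "(\<Prod>x\<in>B. phase (\<epsilon> ! x) w)
    = w ^ card {x\<in>B. \<epsilon> ! x = One} * cnj w ^ card {x\<in>B. \<epsilon> ! x = Star}"
proof -
  have "e = One \<or> e = Star" for e by (cases e) auto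
  then have "B = {x\<in>B. \<epsilon> ! x = One} \<union> {x\<in>B. \<epsilon> ! x = Star}" by blast
  then have "(\<Prod>x\<in>B. phase (\<epsilon> ! x) w)
      = (\<Prod>x\<in>{x\<in>B. \<epsilon> ! x = One} \<union> {x\<in>B. \<epsilon> ! x = Star}. phase (\<epsilon> ! x) w)"
    by simp
  also have "\<dots> = (\<Prod>x\<in>{x\<in>B. \<epsilon> ! x = One}. phase (\<epsilon> ! x) w) * (\<Prod>x\<in>{x\<in>B. \<epsilon> ! x = Star}. phase (\<epsilon> ! x) w)"
    using assms by (intro prod.union_disjoint) auto
  finally show ?thesis by (simp add: phase_def)
qed

text \<open>Character orthogonality on the cyclic group. For congruent exponents every summand is
  \<open>1\<close>, as the roots have modulus one; otherwise multiplying the variable by the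
  primitive root \<open>\<omega>\<close> scales the sum by a factor other than \<open>1\<close>, so
  it vanishes.\<close>

lemma sum_roots_unity_powers:
  assumes m: "m > 0"
  shows "(\<Sum>w | w ^ m = 1. w ^ a * cnj w ^ b) = (if a mod m = b mod m then of_nat m else 0)"
proof -
  let ?R = "{w::complex. w ^ m = 1}"
  define \<omega> where "\<omega> = cis (2 * pi / real m)"
  have pow: "w ^ k = w ^ (k mod m)" if "w \<in> ?R" for w :: complex and k
  proof -
    have "w ^ k = w ^ (m * (k div m) + k mod m)" by simp
    also have "\<dots> = w ^ (k mod m)" using that by (simp only: power_add power_mult) simp
    finally show ?thesis .
  qed
  have cnj1: "w * cnj w = 1" if "w \<in> ?R" for w
  proof -
    have "norm w ^ m = 1" using that by (simp flip: norm_power)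
    then have "norm w = 1" using m power_eq_imp_eq_base[of "norm w" m 1] by simp
    then show ?thesis by (simp add: complex_norm_square[symmetric])
  qed
  have \<omega>: "\<omega> \<in> ?R" using m by (simp add: \<omega>_def Complex.DeMoivre)
  have \<omega>pow: "\<omega> ^ k = cis (2 * pi * real k / real m)" for k
    by (simp add: \<omega>_def Complex.DeMoivre mult_ac)
  show ?thesis
  proof (cases "a mod m = b mod m")
    case True
    have "w ^ a * cnj w ^ b = 1" if "w \<in> ?R" for w
    proof -
      have "w ^ a = w ^ b" using pow[OF that, of a] pow[OF that, of b] True by simp
      then have "w ^ a * cnj w ^ b = (w * cnj w) ^ b" by (simp add: power_mult_distrib)
      then show ?thesis using cnj1[OF that] by simp
    qed
    then show ?thesis using True card_roots_unity_eq[OF m] by simp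
  next
    case False
    have "\<omega> ^ (a mod m) \<noteq> \<omega> ^ (b mod m)"
      using inj_onD[OF bij_betw_imp_inj_on[OF Complex.bij_betw_roots_unity[OF m]], of "a mod m" "b mod m"] False m
      unfolding \<omega>pow by auto
    then have ne: "\<omega> ^ a \<noteq> \<omega> ^ b" using pow[OF \<omega>] by metis
    have "\<omega> ^ a * cnj \<omega> ^ b \<noteq> 1"
    proof
      assume "\<omega> ^ a * cnj \<omega> ^ b = 1"
      then have "\<omega> ^ a * (\<omega> * cnj \<omega>) ^ b = \<omega> ^ b"
        by (simp add: power_mult_distrib mult_ac)
      then show False using ne cnj1[OF \<omega>] by simp
    qed
    moreover have "(\<Sum>w\<in>?R. w ^ a * cnj w ^ b) = \<omega> ^ a * cnj \<omega> ^ b * (\<Sum>w\<in>?R. w ^ a * cnj w ^ b)"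
    proof -
      have "(\<Sum>w\<in>?R. w ^ a * cnj w ^ b) = (\<Sum>w\<in>?R. (\<omega> * w) ^ a * cnj (\<omega> * w) ^ b)"
      \<comment> \<open>Multiplication by \<open>\<omega>\<close> permutes the roots, with
        multiplication by \<open>cnj \<omega>\<close> as its inverse.\<close>
      proof (rule sum.reindex_bij_witness[of _ "\<lambda>w. \<omega> * w" "\<lambda>w. cnj \<omega> * w"])
        fix w
        show "\<omega> * (cnj \<omega> * w) = w" "cnj \<omega> * (\<omega> * w) = w"
          using cnj1[OF \<omega>] by (simp_all flip: mult.assoc add: mult.commute[of "cnj \<omega>" \<omega>])
        then show "(\<omega> * (cnj \<omega> * w)) ^ a * cnj (\<omega> * (cnj \<omega> * w)) ^ b = w ^ a * cnj w ^ b" by (simp only:)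
        assume w: "w \<in> ?R"
        have "cnj \<omega> ^ m = 1" using \<omega> by (simp flip: complex_cnj_power)
        then show "cnj \<omega> * w \<in> ?R" "\<omega> * w \<in> ?R"
          using w \<omega> by (simp_all add: power_mult_distrib)
      qed
      also have "\<dots> = \<omega> ^ a * cnj \<omega> ^ b * (\<Sum>w\<in>?R. w ^ a * cnj w ^ b)"
        by (simp add: sum_distrib_left power_mult_distrib mult_ac)
      finally show ?thesis .
    qed
    ultimately have "(\<Sum>w\<in>?R. w ^ a * cnj w ^ b) = 0" by simp
    then show ?thesis using False by simp
  qed
qed

abbreviation uniform_angle :: "real measure" where
  "uniform_angle \<equiv> uniform_measure lborel {0..2*pi}"

lemma prob_space_uniform_angle: "prob_space uniform_angle"
  by (rule prob_space_uniform_measure) (use pi_gt_zero in \<open>auto simp: ennreal_eq_0_iff simp del: pi_gt_zero\<close>)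

lemma integrable_uniform_angle_cis:
  "integrable uniform_angle (\<lambda>\<theta>. cis \<theta> ^ a * cnj (cis \<theta>) ^ b)"
proof -
  interpret prob_space uniform_angle by (rule prob_space_uniform_angle)
  have "(\<lambda>\<theta>. cis \<theta> ^ a * cnj (cis \<theta>) ^ b) \<in> borel_measurable borel"
    by (intro borel_measurable_continuous_onI continuous_intros)
  then show ?thesis
    by (intro integrable_const_bound[of _ 1]) (auto simp: norm_mult norm_power)
qed

text \<open>Character orthogonality on the circle. For \<open>a \<noteq> b\<close> the integrand is
  \<open>cis (c * \<theta>)\<close> with \<open>c\<close> a nonzero difference of natural numbers,
  and its antiderivative \<open>F\<close> agrees at both ends of the interval.\<close>

lemma integral_uniform_angle_cis:
  "integral\<^sup>L uniform_angle (\<lambda>\<theta>. cis \<theta> ^ a * cnj (cis \<theta>) ^ b) = (if a = b then 1 else 0)"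
proof (cases "a = b")
  case True
  have "cis \<theta> ^ b * cnj (cis \<theta>) ^ b = 1" for \<theta>
    by (simp flip: power_mult_distrib add: cis_cnj cis_mult)
  then show ?thesis
    using True prob_space.prob_space[OF prob_space_uniform_angle] by simp
next
  case False
  define c where "c = real a - real b"
  have c: "c \<noteq> 0" using False by (simp add: c_def)
  have eq: "cis \<theta> ^ a * cnj (cis \<theta>) ^ b = cis (c * \<theta>)" for \<theta>
    unfolding cis_cnj Complex.DeMoivre cis_mult c_def by (simp add: algebra_simps)
  define F where "F = (\<lambda>\<theta>::real. cis (c * \<theta>) / (\<i> * complex_of_real c))"
  have "has_bochner_integral lborel (\<lambda>\<theta>. indicator {0..2*pi} \<theta> *\<^sub>R cis (c * \<theta>)) (F (2*pi) - F 0)"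
  proof (rule has_bochner_integral_FTC_Icc)
    show "(F has_vector_derivative cis (c * \<theta>)) (at \<theta> within {0..2*pi})" for \<theta>
      unfolding F_def cis_conv_exp using c
      by (auto intro!: derivative_eq_intros has_vector_derivative_real_field simp: field_simps)
    show "continuous_on {0..2*pi} (\<lambda>\<theta>. cis (c * \<theta>))" by (intro continuous_intros)
  qed auto
  moreover have "F (2*pi) = F 0"
  proof -
    have "cis (c * (2*pi)) = cis (2 * pi * real a) / cis (2 * pi * real b)"
      by (simp add: c_def cis_divide algebra_simps)
    also have "\<dots> = 1" by (simp add: cis_multiple_2pi)
    finally show ?thesis by (simp add: F_def)
  qed
  ultimately have int0: "(\<integral>\<theta>. indicator {0..2*pi} \<theta> *\<^sub>R cis (c * \<theta>) \<partial>lborel) = 0"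
    by (simp add: has_bochner_integral_integral_eq)
  \<comment> \<open>The interval has length \<open>2*pi\<close>, so the uniform measure has constant
    density \<open>1 / (2*pi)\<close> on it.\<close>
  have "uniform_angle = density lborel (\<lambda>\<theta>. ennreal (indicator {0..2*pi} \<theta> / (2*pi)))"
    unfolding uniform_measure_def
    by (intro arg_cong2[where f=density] refl ext)
       (auto simp: indicator_def divide_ennreal simp flip: ennreal_1)
  then have "integral\<^sup>L uniform_angle (\<lambda>\<theta>. cis (c * \<theta>))
     = (\<integral>\<theta>. (indicator {0..2*pi} \<theta> / (2*pi)) *\<^sub>R cis (c * \<theta>) \<partial>lborel)"
    by (simp only:) (subst integral_density, auto intro!: borel_measurable_continuous_onI continuous_intros)
  also have "\<dots> = (\<integral>\<theta>. (1 / (2*pi)) *\<^sub>R (indicator {0..2*pi} \<theta> *\<^sub>R cis (c * \<theta>)) \<partial>lborel)"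
    by (simp add: mult_ac)
  also have "\<dots> = 0" using int0 by (simp only: integral_scaleR_right scaleR_zero_right)
  finally show ?thesis using False by (simp add: eq)
qed

section \<open>Haar measure as a uniform permutation with independent phases\<close>

definition torus_exp :: "enat \<Rightarrow> nat \<Rightarrow> ((nat \<Rightarrow> complex) \<Rightarrow> complex) \<Rightarrow> complex" where
  "torus_exp s n f = (case s of
     enat m \<Rightarrow> (\<Sum>z\<in>{0..<n} \<rightarrow>\<^sub>E {w. w ^ m = 1}. f z) / of_nat (m ^ n)
   | \<infinity> \<Rightarrow> integral\<^sup>L (PiM {0..<n} (\<lambda>_. uniform_angle)) (\<lambda>\<theta>. f (\<lambda>i. cis (\<theta> i))))"

text \<open>Roots of unity are nonzero, so the position and value of the nonzero entry in row
  \<open>i\<close> reveal \<open>\<sigma> i\<close> and \<open>z i\<close>. Taking \<open>z\<close>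
  extensional removes the freedom outside \<open>{0..<n}\<close>, and the uniform average over the
  group splits into averages over \<open>\<sigma>\<close> and \<open>z\<close>.\<close>

lemma bij_betw_monomial_mat:
  assumes m: "m > 0"
  shows "bij_betw (\<lambda>(\<sigma>, z). monomial_mat n \<sigma> z)
    ({\<sigma>. \<sigma> permutes {0..<n}} \<times> ({0..<n} \<rightarrow>\<^sub>E {w. w ^ m = 1})) (H_fin m n)"
  unfolding bij_betw_def
proof
  let ?D = "{\<sigma>. \<sigma> permutes {0..<n}} \<times> ({0..<n} \<rightarrow>\<^sub>E {w::complex. w ^ m = 1})"
  show "inj_on (\<lambda>(\<sigma>, z). monomial_mat n \<sigma> z) ?D"
  proof (rule inj_onI, clarify)
    fix \<sigma> \<tau> z y
    assume \<sigma>: "\<sigma> permutes {0..<n}" and \<tau>: "\<tau> permutes {0..<n}"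
      and z: "z \<in> {0..<n} \<rightarrow>\<^sub>E {w. w ^ m = 1}" and y: "y \<in> {0..<n} \<rightarrow>\<^sub>E {w. w ^ m = 1}"
      and eq: "monomial_mat n \<sigma> z = monomial_mat n \<tau> y"
    have *: "\<sigma> i = \<tau> i \<and> z i = y i" if i: "i < n" for i
    proof -
      have "z i ^ m = 1" using z i by auto
      then have "z i \<noteq> 0" using m by (auto simp: power_0_left)
      moreover have "\<sigma> i < n" using permutes_in_image[OF \<sigma>, of i] i by simp
      ultimately show ?thesis
        using fun_cong[OF fun_cong[OF eq], of i "\<sigma> i"] i by (auto simp: monomial_mat_def split: if_splits)
    qed
    have "\<sigma> i = \<tau> i" for i
      using * \<sigma> \<tau> by (cases "i < n") (auto simp: permutes_def)
    moreover have "z i = y i" for i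
      using * z y by (cases "i < n") (auto simp: PiE_def extensional_def)
    ultimately show "\<sigma> = \<tau> \<and> z = y" by auto
  qed
  show "(\<lambda>(\<sigma>, z). monomial_mat n \<sigma> z) ` ?D = H_fin m n"
  proof (intro equalityI subsetI)
    fix V assume "V \<in> H_fin m n"
    then obtain \<sigma> z where V: "V = monomial_mat n \<sigma> z" "\<sigma> permutes {0..<n}" "\<forall>i<n. z i ^ m = 1"
      by (auto simp: H_fin_def)
    then have "V = monomial_mat n \<sigma> (restrict z {0..<n})"
      by (auto simp: monomial_mat_def fun_eq_iff)
    then show "V \<in> (\<lambda>(\<sigma>, z). monomial_mat n \<sigma> z) ` ?D"
      using V by (intro image_eqI[of _ _ "(\<sigma>, restrict z {0..<n})"]) auto
  next
    fix V assume "V \<in> (\<lambda>(\<sigma>, z). monomial_mat n \<sigma> z) ` ?D"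
    then obtain \<sigma> z where "V = monomial_mat n \<sigma> z" "\<sigma> permutes {0..<n}" "z \<in> {0..<n} \<rightarrow>\<^sub>E {w. w ^ m = 1}"
      by auto
    moreover from this have "\<forall>i<n. z i ^ m = 1" by auto
    ultimately show "V \<in> H_fin m n" unfolding H_fin_def by blast
  qed
qed

lemma haar_exp_eq_torus_exp:
  assumes "s \<noteq> 0"
  shows "haar_exp s n f
    = (\<Sum>\<sigma> | \<sigma> permutes {0..<n}. torus_exp s n (\<lambda>z. f (monomial_mat n \<sigma> z))) / of_nat (fact n)"
proof (cases s)
  case (enat m)
  then have m: "m > 0" using assms by (simp add: zero_enat_def)
  let ?D = "{\<sigma>. \<sigma> permutes {0..<n}} \<times> ({0..<n} \<rightarrow>\<^sub>E {w::complex. w ^ m = 1})"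
  have "card (H_fin m n) = card ?D" using bij_betw_same_card[OF bij_betw_monomial_mat[OF m, of n]] by simp
  also have "\<dots> = fact n * m ^ n"
    by (simp add: card_cartesian_product card_permutations card_PiE card_roots_unity_eq[OF m])
  finally have "card (H_fin m n) = fact n * m ^ n" .
  moreover have "(\<Sum>V\<in>H_fin m n. f V)
     = (\<Sum>\<sigma> | \<sigma> permutes {0..<n}. \<Sum>z\<in>{0..<n} \<rightarrow>\<^sub>E {w. w ^ m = 1}. f (monomial_mat n \<sigma> z))"
    unfolding sum.cartesian_product
    by (subst sum.reindex_bij_betw[OF bij_betw_monomial_mat[OF m], symmetric]) (simp add: case_prod_unfold)
  ultimately show ?thesis
    by (simp add: enat haar_exp_def torus_exp_def sum_divide_distrib[symmetric] mult.commute)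
qed (simp add: haar_exp_def torus_exp_def)

lemma balanced_block_empty: "balanced_block s \<epsilon> {}"
  by (cases s) (auto simp: balanced_block_def)

text \<open>Collecting the factors at each row \<open>a\<close> gives \<open>z a\<close> the
  exponent \<open>ones i a\<close> and its conjugate the exponent \<open>stars i a\<close>. The
  average then factors over the independent phases, and orthogonality makes each factor the
  indicator of a balanced level set.\<close>

lemma torus_exp_sum_phases:
  assumes s: "s \<noteq> 0" and S: "finite S" and U: "finite U" and i: "\<And>i. i \<in> S \<Longrightarrow> i ` U \<subseteq> {0..<n}"
  shows "torus_exp s n (\<lambda>z. \<Sum>i\<in>S. c i * (\<Prod>x\<in>U. phase (\<epsilon> ! x) (z (i x))))
    = (\<Sum>i\<in>S. c i * (if \<forall>a\<in>{0..<n}. balanced_block s \<epsilon> {x\<in>U. i x = a} then 1 else 0))"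
proof -
  define ones where "ones = (\<lambda>(i :: nat \<Rightarrow> nat) a. card {x\<in>{x\<in>U. i x = a}. \<epsilon> ! x = One})"
  define stars where "stars = (\<lambda>(i :: nat \<Rightarrow> nat) a. card {x\<in>{x\<in>U. i x = a}. \<epsilon> ! x = Star})"
  have grouped: "(\<Prod>x\<in>U. phase (\<epsilon> ! x) (z (i x)))
      = (\<Prod>a\<in>{0..<n}. z a ^ ones i a * cnj (z a) ^ stars i a)" if "i \<in> S" for i and z :: "nat \<Rightarrow> complex"
  proof -
    have "(\<Prod>x\<in>U. phase (\<epsilon> ! x) (z (i x)))
       = (\<Prod>a\<in>{0..<n}. \<Prod>x\<in>{x\<in>U. i x = a}. phase (\<epsilon> ! x) (z (i x)))"
      using U i[OF that] by (intro prod.group[symmetric]) auto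
    also have "\<dots> = (\<Prod>a\<in>{0..<n}. \<Prod>x\<in>{x\<in>U. i x = a}. phase (\<epsilon> ! x) (z a))"
      by (intro prod.cong) auto
    finally show ?thesis using U by (simp add: prod_phase ones_def stars_def)
  qed
  have bal: "(\<Prod>a\<in>{0..<n}. if balanced_block s \<epsilon> {x\<in>U. i x = a} then 1 else (0::complex))
     = (if \<forall>a\<in>{0..<n}. balanced_block s \<epsilon> {x\<in>U. i x = a} then 1 else 0)" for i
    by auto
  show ?thesis
  proof (cases s)
    case (enat m)
    then have m: "m > 0" using s by (simp add: zero_enat_def)
    let ?R = "{w::complex. w ^ m = 1}"
    have finR: "finite ?R" using card_roots_unity_eq[OF m] m by (metis card.infinite less_irrefl)
    have one: "(\<Sum>z\<in>{0..<n} \<rightarrow>\<^sub>E ?R. \<Prod>a\<in>{0..<n}. z a ^ ones i a * cnj (z a) ^ stars i a)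
      = of_nat (m ^ n) * (if \<forall>a\<in>{0..<n}. balanced_block s \<epsilon> {x\<in>U. i x = a} then 1 else 0)" for i
    proof -
      have "(\<Sum>z\<in>{0..<n} \<rightarrow>\<^sub>E ?R. \<Prod>a\<in>{0..<n}. z a ^ ones i a * cnj (z a) ^ stars i a)
        = (\<Prod>a\<in>{0..<n}. \<Sum>w\<in>?R. w ^ ones i a * cnj w ^ stars i a)"
        using finR by (subst prod_sum_PiE) auto
      also have "\<dots> = (\<Prod>a\<in>{0..<n}. of_nat m * (if balanced_block s \<epsilon> {x\<in>U. i x = a} then 1 else 0))"
        by (intro prod.cong refl, subst sum_roots_unity_powers[OF m])
           (auto simp: enat balanced_block_def ones_def stars_def)
      finally show ?thesis by (simp only: prod.distrib bal) simp
    qed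
    have "(\<Sum>z\<in>{0..<n} \<rightarrow>\<^sub>E ?R. \<Sum>i\<in>S. c i * (\<Prod>x\<in>U. phase (\<epsilon> ! x) (z (i x))))
      = (\<Sum>i\<in>S. c i * (\<Sum>z\<in>{0..<n} \<rightarrow>\<^sub>E ?R. \<Prod>a\<in>{0..<n}. z a ^ ones i a * cnj (z a) ^ stars i a))"
      by (subst sum.swap) (simp add: grouped sum_distrib_left)
    also have "\<dots> = of_nat (m ^ n) *
       (\<Sum>i\<in>S. c i * (if \<forall>a\<in>{0..<n}. balanced_block s \<epsilon> {x\<in>U. i x = a} then 1 else 0))"
      unfolding one sum_distrib_left by (intro sum.cong) auto
    finally show ?thesis using m by (simp add: torus_exp_def enat)
  next
    case infinity
    interpret product_prob_space "\<lambda>_::nat. uniform_angle" "{0..<n}"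
      by (intro product_prob_spaceI prob_space_uniform_angle)
    have int: "integrable (PiM {0..<n} (\<lambda>_. uniform_angle))
        (\<lambda>\<theta>. \<Prod>a\<in>{0..<n}. cis (\<theta> a) ^ ones i a * cnj (cis (\<theta> a)) ^ stars i a)" for i
      by (rule product_integrable_prod) (auto intro: integrable_uniform_angle_cis)
    have one: "(\<integral>\<theta>. (\<Prod>a\<in>{0..<n}. cis (\<theta> a) ^ ones i a * cnj (cis (\<theta> a)) ^ stars i a)
        \<partial>PiM {0..<n} (\<lambda>_. uniform_angle))
      = (if \<forall>a\<in>{0..<n}. balanced_block s \<epsilon> {x\<in>U. i x = a} then 1 else 0)" for i
    proof -
      have "(\<integral>\<theta>. (\<Prod>a\<in>{0..<n}. cis (\<theta> a) ^ ones i a * cnj (cis (\<theta> a)) ^ stars i a)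
          \<partial>PiM {0..<n} (\<lambda>_. uniform_angle))
        = (\<Prod>a\<in>{0..<n}. \<integral>\<theta>. cis \<theta> ^ ones i a * cnj (cis \<theta>) ^ stars i a \<partial>uniform_angle)"
        by (rule product_integral_prod) (auto intro: integrable_uniform_angle_cis)
      also have "\<dots> = (\<Prod>a\<in>{0..<n}. if balanced_block s \<epsilon> {x\<in>U. i x = a} then 1 else 0)"
        by (intro prod.cong refl, subst integral_uniform_angle_cis)
           (auto simp: infinity balanced_block_def ones_def stars_def)
      finally show ?thesis by (simp only: bal)
    qed
    have "torus_exp s n (\<lambda>z. \<Sum>i\<in>S. c i * (\<Prod>x\<in>U. phase (\<epsilon> ! x) (z (i x))))
      = (\<integral>\<theta>. (\<Sum>i\<in>S. c i * (\<Prod>a\<in>{0..<n}. cis (\<theta> a) ^ ones i a * cnj (cis (\<theta> a)) ^ stars i a))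
          \<partial>PiM {0..<n} (\<lambda>_. uniform_angle))"
      by (simp add: torus_exp_def infinity grouped del: cis_cnj)
    also have "\<dots> = (\<Sum>i\<in>S. c i * (\<integral>\<theta>. (\<Prod>a\<in>{0..<n}. cis (\<theta> a) ^ ones i a * cnj (cis (\<theta> a)) ^ stars i a)
          \<partial>PiM {0..<n} (\<lambda>_. uniform_angle)))"
      using int by (subst Bochner_Integration.integral_sum) auto
    finally show ?thesis by (simp only: one)
  qed
qed

text \<open>A product of entries vanishes unless \<open>\<sigma> (i x) = i (g x)\<close> throughout
  \<open>U\<close>, in which case it is a product of phases. Averaging the phases first and then
  exchanging the sums leaves, for each \<open>i\<close> with balanced level sets, the number of
  intertwining permutations.\<close>

lemma haar_exp_sum_entries:
  assumes s: "s \<noteq> 0" and U: "finite U" and g: "g ` U \<subseteq> U"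
  shows "haar_exp s n (\<lambda>V. \<Sum>i\<in>U \<rightarrow>\<^sub>E {0..<n}. \<Prod>x\<in>U. ent (\<epsilon> ! x) V (i x) (i (g x)))
    = of_nat (\<Sum>i\<in>U \<rightarrow>\<^sub>E {0..<n}. if \<forall>a\<in>{0..<n}. balanced_block s \<epsilon> {x\<in>U. i x = a}
            then card {\<sigma>. \<sigma> permutes {0..<n} \<and> (\<forall>x\<in>U. \<sigma> (i x) = i (g x))} else 0) / of_nat (fact n)"
proof -
  let ?I = "U \<rightarrow>\<^sub>E {0..<n}"
  define c :: "(nat \<Rightarrow> nat) \<Rightarrow> (nat \<Rightarrow> nat) \<Rightarrow> complex"
    where "c = (\<lambda>\<sigma> i. if \<forall>x\<in>U. \<sigma> (i x) = i (g x) then 1 else 0)"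
  define b :: "(nat \<Rightarrow> nat) \<Rightarrow> complex"
    where "b = (\<lambda>i. if \<forall>a\<in>{0..<n}. balanced_block s \<epsilon> {x\<in>U. i x = a} then 1 else 0)"
  have finI: "finite ?I" using U by (simp add: finite_PiE)
  have entries: "(\<Prod>x\<in>U. ent (\<epsilon> ! x) (monomial_mat n \<sigma> z) (i x) (i (g x)))
      = c \<sigma> i * (\<Prod>x\<in>U. phase (\<epsilon> ! x) (z (i x)))" if i: "i \<in> ?I" for \<sigma> z i
  proof (cases "\<forall>x\<in>U. \<sigma> (i x) = i (g x)")
    case True
    have lt: "i x < n" "i (g x) < n" if "x \<in> U" for x
      using i g that by (auto simp: PiE_def Pi_def image_subset_iff)
    have "ent (\<epsilon> ! x) (monomial_mat n \<sigma> z) (i x) (i (g x)) = phase (\<epsilon> ! x) (z (i x))" if "x \<in> U" for x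
      using lt[OF that] True that by (auto simp: ent_def monomial_mat_def phase_def split: sym.split)
    then show ?thesis using True by (simp add: c_def)
  next
    case False
    then obtain x where x: "x \<in> U" "\<sigma> (i x) \<noteq> i (g x)" by blast
    then have "ent (\<epsilon> ! x) (monomial_mat n \<sigma> z) (i x) (i (g x)) = 0"
      by (auto simp: ent_def monomial_mat_def split: sym.split)
    then show ?thesis using U x False by (auto simp: c_def)
  qed
  have "haar_exp s n (\<lambda>V. \<Sum>i\<in>?I. \<Prod>x\<in>U. ent (\<epsilon> ! x) V (i x) (i (g x)))
     = (\<Sum>\<sigma> | \<sigma> permutes {0..<n}. torus_exp s n (\<lambda>z. \<Sum>i\<in>?I. c \<sigma> i * (\<Prod>x\<in>U. phase (\<epsilon> ! x) (z (i x)))))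
        / of_nat (fact n)"
    by (simp add: haar_exp_eq_torus_exp[OF s] entries)
  also have "\<dots> = (\<Sum>\<sigma> | \<sigma> permutes {0..<n}. \<Sum>i\<in>?I. c \<sigma> i * b i) / of_nat (fact n)"
    unfolding b_def using finI U
    by (subst torus_exp_sum_phases[OF s]) (auto simp: PiE_def)
  also have "(\<Sum>\<sigma> | \<sigma> permutes {0..<n}. \<Sum>i\<in>?I. c \<sigma> i * b i)
     = (\<Sum>i\<in>?I. (\<Sum>\<sigma> | \<sigma> permutes {0..<n}. c \<sigma> i) * b i)"
    by (subst sum.swap) (simp add: sum_distrib_right)
  also have "\<dots> = (\<Sum>i\<in>?I. of_nat (if \<forall>a\<in>{0..<n}. balanced_block s \<epsilon> {x\<in>U. i x = a}
            then card {\<sigma>. \<sigma> permutes {0..<n} \<and> (\<forall>x\<in>U. \<sigma> (i x) = i (g x))} else 0))"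
  proof (intro sum.cong refl)
    fix i
    have "(\<Sum>\<sigma> | \<sigma> permutes {0..<n}. c \<sigma> i)
      = of_nat (card ({\<sigma>. \<sigma> permutes {0..<n}} \<inter> {\<sigma>. \<forall>x\<in>U. \<sigma> (i x) = i (g x)}))"
      unfolding c_def by (simp add: sum.If_cases finite_permutations)
    then show "(\<Sum>\<sigma> | \<sigma> permutes {0..<n}. c \<sigma> i) * b i
      = of_nat (if \<forall>a\<in>{0..<n}. balanced_block s \<epsilon> {x\<in>U. i x = a}
            then card {\<sigma>. \<sigma> permutes {0..<n} \<and> (\<forall>x\<in>U. \<sigma> (i x) = i (g x))} else 0)"
      by (simp add: b_def Int_def)
  qed
  finally show ?thesis by (simp only: of_nat_sum)
qed

section \<open>Invariant partitions and connectedness\<close>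

text \<open>An invariant partition whose blocks each stay in one \<open>W b\<close> is an
  independent choice of an invariant partition of every \<open>W b\<close>, because \<open>g\<close>
  preserves each piece. This turns a product of moments into a single count.\<close>

lemma card_invariant_partitions_UN:
  assumes I: "finite I" and disj: "disjoint_family_on W I"
    and g: "\<And>b. b \<in> I \<Longrightarrow> g ` W b = W b"
  shows "(\<Prod>b\<in>I. card (invariant_partitions bal g (W b)))
    = card {p \<in> invariant_partitions bal g (\<Union>b\<in>I. W b). \<forall>X\<in>p. \<exists>b\<in>I. X \<subseteq> W b}"
proof -
  let ?Q = "\<lambda>b. invariant_partitions bal g (W b)"
  let ?R = "{p \<in> invariant_partitions bal g (\<Union>b\<in>I. W b). \<forall>X\<in>p. \<exists>b\<in>I. X \<subseteq> W b}"
  have same: "b = b'" if "b \<in> I" "b' \<in> I" "x \<in> W b" "x \<in> W b'" for b b' x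
    using disj that by (auto simp: disjoint_family_on_def)
  have QD: "partition_on (W b) q" "\<And>X. X \<in> q \<Longrightarrow> bal X" "\<And>X. X \<in> q \<Longrightarrow> g ` X \<in> q"
    "\<And>X. X \<in> q \<Longrightarrow> X \<subseteq> W b \<and> X \<noteq> {}" if "q \<in> ?Q b" for q b
    using that by (auto simp: invariant_partitions_def partition_on_def)
  have RD: "partition_on (\<Union>b\<in>I. W b) p" "\<And>X. X \<in> p \<Longrightarrow> bal X" "\<And>X. X \<in> p \<Longrightarrow> g ` X \<in> p"
    "\<And>X. X \<in> p \<Longrightarrow> \<exists>b\<in>I. X \<subseteq> W b" if "p \<in> ?R" for p
    using that by (auto simp: invariant_partitions_def)
  have "bij_betw (\<lambda>q. \<Union>b\<in>I. q b) (PiE I ?Q) ?R"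
  proof (rule bij_betw_byWitness[where f' = "\<lambda>p. \<lambda>b\<in>I. {X\<in>p. X \<subseteq> W b}"])
    show "\<forall>q\<in>PiE I ?Q. (\<lambda>b\<in>I. {X\<in>\<Union>b\<in>I. q b. X \<subseteq> W b}) = q"
    proof (intro ballI ext)
      fix q b assume q: "q \<in> PiE I ?Q"
      show "(\<lambda>b\<in>I. {X\<in>\<Union>b\<in>I. q b. X \<subseteq> W b}) b = q b"
      proof (cases "b \<in> I")
        case True
        \<comment> \<open>A nonempty block of \<open>q b'\<close> inside \<open>W b\<close> forces
          \<open>b = b'\<close> by disjointness.\<close>
        have "X \<in> q b" if "b' \<in> I" "X \<in> q b'" "X \<subseteq> W b" for X b'
        proof -
          have "q b' \<in> ?Q b'" using q that by auto
          then have "X \<subseteq> W b'" "X \<noteq> {}" using QD(4) that by blast+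
          then have "b = b'" using same[OF True that(1)] that(3) by blast
          then show ?thesis using that by simp
        qed
        moreover have "q b \<in> ?Q b" using q True by auto
        then have "X \<subseteq> W b" if "X \<in> q b" for X using QD(4) that by blast
        ultimately show ?thesis using True by auto
      qed (use q in \<open>auto simp: PiE_def extensional_def\<close>)
    qed
    show "\<forall>p\<in>?R. (\<Union>b\<in>I. (\<lambda>b\<in>I. {X\<in>p. X \<subseteq> W b}) b) = p"
      using RD(4) by fastforce
    show "(\<lambda>q. \<Union>b\<in>I. q b) ` PiE I ?Q \<subseteq> ?R"
    proof (rule image_subsetI)
      fix q assume "q \<in> PiE I ?Q"
      then have q: "q b \<in> ?Q b" if "b \<in> I" for b using that by auto
      have "partition_on (\<Union>b\<in>I. W b) (\<Union>b\<in>I. q b)"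
      proof (rule partition_onI)
        show "\<Union>(\<Union>b\<in>I. q b) = (\<Union>b\<in>I. W b)"
        proof -
          have "\<Union>(q b) = W b" if "b \<in> I" for b using QD(1)[OF q[OF that]] by (simp add: partition_on_def)
          then show ?thesis by blast
        qed
        show "{} \<notin> (\<Union>b\<in>I. q b)" using QD(4)[OF q] by blast
        fix X Y assume "X \<in> (\<Union>b\<in>I. q b)" "Y \<in> (\<Union>b\<in>I. q b)" "X \<noteq> Y"
        then obtain b b' where b: "b \<in> I" "X \<in> q b" "b' \<in> I" "Y \<in> q b'" by blast
        show "disjnt X Y"
        proof (rule ccontr)
          assume "\<not> disjnt X Y"
          then obtain x where x: "x \<in> X" "x \<in> Y" by (auto simp: disjnt_def)
          then have "x \<in> W b" "x \<in> W b'" using b QD(4)[OF q] by blast+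
          then have "b = b'" using same b by blast
          then show False
            using partition_on_block_unique[OF QD(1)[OF q[OF b(1)]] b(2) _ x] b \<open>X \<noteq> Y\<close> by simp
        qed
      qed
      then show "(\<Union>b\<in>I. q b) \<in> ?R"
        using QD(2,3,4)[OF q] unfolding invariant_partitions_def by blast
    qed
    show "(\<lambda>p. \<lambda>b\<in>I. {X\<in>p. X \<subseteq> W b}) ` ?R \<subseteq> PiE I ?Q"
    proof (rule image_subsetI, rule PiE_I)
      fix p b assume p: "p \<in> ?R" and b: "b \<in> I"
      have "\<Union>{X\<in>p. X \<subseteq> W b} = W b"
      proof (intro equalityI subsetI)
        fix x assume x: "x \<in> W b"
        then obtain X where X: "X \<in> p" "x \<in> X" using RD(1)[OF p] b by (auto simp: partition_on_def)
        then obtain b' where "b' \<in> I" "X \<subseteq> W b'" using RD(4)[OF p] by blast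
        then have "X \<subseteq> W b" using same[of b b' x] x X b by auto
        then show "x \<in> \<Union>{X\<in>p. X \<subseteq> W b}" using X by blast
      qed auto
      then have "partition_on (W b) {X\<in>p. X \<subseteq> W b}"
        using RD(1)[OF p] by (auto simp: partition_on_def intro: pairwise_subset)
      moreover have "g ` X \<in> {X\<in>p. X \<subseteq> W b}" if "X \<in> {X\<in>p. X \<subseteq> W b}" for X
        using that RD(3)[OF p] g[OF b] by blast
      ultimately show "(\<lambda>b\<in>I. {X\<in>p. X \<subseteq> W b}) b \<in> ?Q b"
        using RD(2)[OF p] b by (auto simp: invariant_partitions_def)
    qed auto
  qed
  then have "card (PiE I ?Q) = card ?R" by (rule bij_betw_same_card)
  then show ?thesis by (simp only: card_PiE[OF I])
qed

text \<open>Taking images under \<open>g\<close> is injective on subsets of \<open>U\<close>, and an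
  injective self-map of the finite set \<open>p\<close> is onto.\<close>

lemma image_blocks_eq_iff:
  assumes U: "finite U" and g: "inj_on g U" and p: "partition_on U p"
  shows "(\<lambda>X. g ` X) ` p = p \<longleftrightarrow> (\<forall>X\<in>p. g ` X \<in> p)"
proof
  assume *: "\<forall>X\<in>p. g ` X \<in> p"
  have "p \<subseteq> Pow U" using p by (auto simp: partition_on_def)
  then have "inj_on (\<lambda>X. g ` X) p" using g by (meson inj_on_image_Pow inj_on_subset)
  then show "(\<lambda>X. g ` X) ` p = p"
    using * finite_elements[OF U p] by (intro endo_inj_surj) auto
qed auto

text \<open>A separated set is closed under the relation that generates the join, so it contains the
  class of each of its points; conversely every class is itself separated.\<close>

lemma join_part_eq_one_block_iff:
  assumes p: "partition_on U p" and q: "\<Union>q \<subseteq> U" and ne: "U \<noteq> {}"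
  shows "join_part U p q = {U} \<longleftrightarrow> (\<forall>T\<subseteq>U. T \<noteq> {} \<longrightarrow> separated (p \<union> q) T \<longrightarrow> T = U)"
proof -
  let ?R = "part_rel p \<union> part_rel q"
  have RU: "x \<in> U \<and> y \<in> U" if "(x, y) \<in> ?R" for x y
    using that p q by (auto simp: part_rel_def partition_on_def)
  have trU: "x \<in> U \<and> y \<in> U" if "(x, y) \<in> ?R\<^sup>+" for x y
    using that by (induction rule: trancl_induct) (use RU in blast)+
  show ?thesis
  proof
    assume join: "join_part U p q = {U}"
    show "\<forall>T\<subseteq>U. T \<noteq> {} \<longrightarrow> separated (p \<union> q) T \<longrightarrow> T = U"
    proof (intro allI impI equalityI)
      fix T assume T: "T \<subseteq> U" "T \<noteq> {}" "separated (p \<union> q) T"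
      then obtain x where x: "x \<in> T" "x \<in> U" by blast
      have closed: "y \<in> T" if "z \<in> T" "(z, y) \<in> ?R" for z y
        using that T(3) unfolding separated_def part_rel_def by blast
      have "?R\<^sup>+ `` {x} = U"
        using quotientI[OF x(2), of "?R\<^sup>+"] join by (simp add: join_part_def)
      moreover have "y \<in> T" if "(x, y) \<in> ?R\<^sup>+" for y
        using that by (induction rule: trancl_induct) (use closed x(1) in blast)+
      ultimately show "U \<subseteq> T" by blast
    qed auto
  next
    assume conn: "\<forall>T\<subseteq>U. T \<noteq> {} \<longrightarrow> separated (p \<union> q) T \<longrightarrow> T = U"
    have "?R\<^sup>+ `` {x} = U" if x: "x \<in> U" for x
    proof -
      \<comment> \<open>The transitive closure supplies no reflexivity; it comes from the blocks of
        \<open>p\<close>, which cover \<open>U\<close>.\<close>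
      have "(x, x) \<in> ?R" using p x by (auto simp: part_rel_def partition_on_def)
      then have "?R\<^sup>+ `` {x} \<noteq> {}" by blast
      moreover have "?R\<^sup>+ `` {x} \<subseteq> U" using trU by blast
      moreover have "separated (p \<union> q) (?R\<^sup>+ `` {x})"
        unfolding separated_def
      proof
        fix X assume X: "X \<in> p \<union> q"
        have "y \<in> ?R\<^sup>+ `` {x}" if "z \<in> X" "z \<in> ?R\<^sup>+ `` {x}" "y \<in> X" for y z
        proof -
          have "(z, y) \<in> ?R" using X that by (auto simp: part_rel_def)
          then show ?thesis using that(2) by (auto intro: trancl_into_trancl)
        qed
        then show "X \<subseteq> ?R\<^sup>+ `` {x} \<or> X \<inter> ?R\<^sup>+ `` {x} = {}" by blast
      qed
      ultimately show ?thesis using conn by blast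
    qed
    then show "join_part U p q = {U}"
      using ne unfolding join_part_def quotient_def by auto
  qed
qed

text \<open>With \<open>W j\<close> the positions of trace \<open>j\<close>, these sets are the
  hyperedges that a partition of positions induces on the trace indices, where the partitions of the
  cumulant formula live.\<close>

definition touched :: "('b \<Rightarrow> 'a set) \<Rightarrow> 'b set \<Rightarrow> 'a set \<Rightarrow> 'b set" where
  "touched W A X = {j\<in>A. X \<inter> W j \<noteq> {}}"

lemma touched_subset_iff:
  assumes "disjoint_family_on W A" "X \<subseteq> (\<Union>j\<in>A. W j)" "B \<subseteq> A"
  shows "touched W A X \<subseteq> B \<longleftrightarrow> X \<subseteq> (\<Union>j\<in>B. W j)"
proof
  assume *: "touched W A X \<subseteq> B"
  show "X \<subseteq> (\<Union>j\<in>B. W j)"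
  proof
    fix x assume x: "x \<in> X"
    then obtain j where "j \<in> A" "x \<in> W j" using assms(2) by blast
    then have "j \<in> B" using * x by (auto simp: touched_def)
    then show "x \<in> (\<Union>j\<in>B. W j)" using \<open>x \<in> W j\<close> by blast
  qed
next
  assume *: "X \<subseteq> (\<Union>j\<in>B. W j)"
  show "touched W A X \<subseteq> B"
  proof
    fix j assume "j \<in> touched W A X"
    then obtain x where j: "j \<in> A" "x \<in> X" "x \<in> W j" by (auto simp: touched_def)
    then obtain j' where "j' \<in> B" "x \<in> W j'" using * by blast
    then have "j = j'" using assms(1,3) j by (auto simp: disjoint_family_on_def)
    then show "j \<in> B" using \<open>j' \<in> B\<close> by simp
  qed
qed

text \<open>Including the sets \<open>W j\<close> among the edges glues each trace together, so
  separated sets of positions correspond to separated sets of indices: take all \<open>j\<close>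
  with \<open>W j \<subseteq> S\<close> one way and the union of the \<open>W j\<close> the other.
  Nonempty \<open>W j\<close> keep nonempty sets nonempty.\<close>

lemma separated_touched_iff:
  assumes disj: "disjoint_family_on W A" and ne: "\<And>j. j \<in> A \<Longrightarrow> W j \<noteq> {}"
    and p: "\<And>X. X \<in> p \<Longrightarrow> X \<subseteq> (\<Union>j\<in>A. W j)"
  shows "(\<forall>T\<subseteq>A. T \<noteq> {} \<longrightarrow> separated (touched W A ` p) T \<longrightarrow> T = A)
    \<longleftrightarrow> (\<forall>S\<subseteq>\<Union>j\<in>A. W j. S \<noteq> {} \<longrightarrow> separated (p \<union> W ` A) S \<longrightarrow> S = (\<Union>j\<in>A. W j))"
    (is "?L \<longleftrightarrow> ?R")
proof -
  have same: "j = j'" if "j \<in> A" "j' \<in> A" "x \<in> W j" "x \<in> W j'" for j j' x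
    using disj that by (auto simp: disjoint_family_on_def)
  show ?thesis
  proof
    assume L: ?L
    show ?R
    proof (intro allI impI)
      fix S assume S: "S \<subseteq> (\<Union>j\<in>A. W j)" "S \<noteq> {}" "separated (p \<union> W ` A) S"
      define T where "T = {j\<in>A. W j \<subseteq> S}"
      \<comment> \<open>Since \<open>W j\<close> is itself an edge, meeting \<open>S\<close> already
        means lying inside \<open>S\<close>.\<close>
      have inT: "j \<in> T" if "j \<in> A" "x \<in> W j" "x \<in> S" for j x
        using that S(3) by (auto simp: T_def separated_def)
      have "T \<noteq> {}" using S(1,2) inT by blast
      moreover have "separated (touched W A ` p) T"
        unfolding separated_def
      proof
        fix E assume "E \<in> touched W A ` p"
        then obtain X where X: "X \<in> p" "E = touched W A X" by blast
        then consider "X \<subseteq> S" | "X \<inter> S = {}" using S(3) by (auto simp: separated_def)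
        then show "E \<subseteq> T \<or> E \<inter> T = {}"
        proof cases
          case 1
          then have "E \<subseteq> T" using inT X(2) by (auto simp: touched_def)
          then show ?thesis by simp
        next
          case 2
          then have "E \<inter> T = {}" using X(2) by (auto simp: touched_def T_def)
          then show ?thesis by simp
        qed
      qed
      moreover have "T \<subseteq> A" by (auto simp: T_def)
      ultimately have "T = A" using L by blast
      then show "S = (\<Union>j\<in>A. W j)" using S(1) by (auto simp: T_def)
    qed
  next
    assume R: ?R
    show ?L
    proof (intro allI impI)
      fix T assume T: "T \<subseteq> A" "T \<noteq> {}" "separated (touched W A ` p) T"
      define S where "S = (\<Union>j\<in>T. W j)"
      have "S \<subseteq> (\<Union>j\<in>A. W j)" "S \<noteq> {}" using T ne by (auto simp: S_def)
      moreover have "separated (p \<union> W ` A) S"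
        unfolding separated_def
      proof
        fix E assume "E \<in> p \<union> W ` A"
        then show "E \<subseteq> S \<or> E \<inter> S = {}"
        proof
          assume E: "E \<in> p"
          then consider "touched W A E \<subseteq> T" | "touched W A E \<inter> T = {}"
            using T(3) by (auto simp: separated_def)
          then show ?thesis
          proof cases
            case 1
            then show ?thesis using touched_subset_iff[OF disj p[OF E] T(1)] by (simp add: S_def)
          next
            case 2
            then have "E \<inter> S = {}" using T(1) unfolding touched_def S_def by blast
            then show ?thesis by simp
          qed
        next
          assume "E \<in> W ` A"
          then obtain j where j: "j \<in> A" "E = W j" by blast
          show ?thesis
          proof (cases "j \<in> T")
            case False
            then have "E \<inter> S = {}" using same j T(1) unfolding S_def by blast
            then show ?thesis by simp
          qed (use j in \<open>auto simp: S_def\<close>)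
        qed
      qed
      ultimately have S: "S = (\<Union>j\<in>A. W j)" using R by blast
      have "j \<in> T" if j: "j \<in> A" for j
      proof -
        obtain x where x: "x \<in> W j" using ne j by blast
        then have "x \<in> S" using S j by blast
        then obtain j' where "j' \<in> T" "x \<in> W j'" by (auto simp: S_def)
        then show ?thesis using same[OF j _ x] T(1) by blast
      qed
      then show "T = A" using T(1) by blast
    qed
  qed
qed

text \<open>The inversion from moments to cumulants: the product over the blocks of
  \<open>\<pi>\<close> counts the invariant \<open>p\<close> whose touched sets are compatible with
  \<open>\<pi>\<close>. After exchanging the sums, \<open>sum_part_moebius_compatible\<close> gives
  the weight of \<open>p\<close>, and \<open>conn\<close> reads its connectedness condition as the
  join condition.\<close>

lemma sum_part_moebius_card_invariant:
  fixes W :: "'b \<Rightarrow> 'a set"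
  assumes A: "finite A" "A \<noteq> {}" and disj: "disjoint_family_on W A"
    and W: "\<And>j. j \<in> A \<Longrightarrow> finite (W j) \<and> W j \<noteq> {} \<and> g ` W j = W j"
  shows "(\<Sum>\<pi> | partition_on A \<pi>.
      part_moebius \<pi> * (\<Prod>B\<in>\<pi>. of_nat (card (invariant_partitions bal g (\<Union>j\<in>B. W j)))))
    = of_nat (card {p \<in> invariant_partitions bal g (\<Union>j\<in>A. W j).
        join_part (\<Union>j\<in>A. W j) p (W ` A) = {\<Union>j\<in>A. W j}})"
proof -
  let ?U = "\<Union>j\<in>A. W j"
  let ?Q = "invariant_partitions bal g ?U"
  let ?P = "{\<pi>. partition_on A \<pi>}"
  have finU: "finite ?U" using A W by blast
  have finQ: "finite ?Q"
    by (rule finite_subset[OF _ finitely_many_partition_on[OF finU]]) (auto simp: invariant_partitions_def)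
  have finP: "finite ?P" using A(1) by (rule finitely_many_partition_on)
  have QU: "X \<subseteq> ?U" if "p \<in> ?Q" "X \<in> p" for p X
    using that by (auto simp: invariant_partitions_def partition_on_def)
  have term_eq: "(\<Prod>B\<in>\<pi>. of_nat (card (invariant_partitions bal g (\<Union>j\<in>B. W j))))
     = (\<Sum>p\<in>?Q. if \<pi> \<in> compatible_partitions (touched W A ` p) A then 1 else (0::complex))"
    if pi: "partition_on A \<pi>" for \<pi>
  proof -
    have sub: "B \<subseteq> A" if "B \<in> \<pi>" for B using pi that by (auto simp: partition_on_def)
    have UN: "(\<Union>B\<in>\<pi>. \<Union>j\<in>B. W j) = ?U" using pi by (auto simp: partition_on_def)
    have "disjoint_family_on (\<lambda>B. \<Union>j\<in>B. W j) \<pi>"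
      unfolding disjoint_family_on_def
    proof (intro ballI impI)
      fix B C assume BC: "B \<in> \<pi>" "C \<in> \<pi>" "B \<noteq> C"
      then have "B \<inter> C = {}" using pi by (auto simp: partition_on_def disjoint_def)
      then have "W i \<inter> W j = {}" if "i \<in> B" "j \<in> C" for i j
        using that disj sub[OF BC(1)] sub[OF BC(2)] disjoint_family_onD[OF disj, of i j] by blast
      then show "(\<Union>j\<in>B. W j) \<inter> (\<Union>j\<in>C. W j) = {}" by blast
    qed
    moreover have "g ` (\<Union>j\<in>B. W j) = (\<Union>j\<in>B. W j)" if "B \<in> \<pi>" for B
      using W sub[OF that] by (simp add: image_UN subset_iff)
    ultimately have "(\<Prod>B\<in>\<pi>. card (invariant_partitions bal g (\<Union>j\<in>B. W j)))
      = card {p \<in> ?Q. \<forall>X\<in>p. \<exists>B\<in>\<pi>. X \<subseteq> (\<Union>j\<in>B. W j)}"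
      using card_invariant_partitions_UN[of \<pi> "\<lambda>B. \<Union>j\<in>B. W j" g bal] finite_elements[OF A(1) pi]
      unfolding UN by blast
    \<comment> \<open>A block of \<open>p\<close> lies over the traces in \<open>B\<close> exactly
      when the set of traces it touches is contained in \<open>B\<close>.\<close>
    also have "{p \<in> ?Q. \<forall>X\<in>p. \<exists>B\<in>\<pi>. X \<subseteq> (\<Union>j\<in>B. W j)}
      = {p \<in> ?Q. \<pi> \<in> compatible_partitions (touched W A ` p) A}"
      using touched_subset_iff[OF disj QU sub] pi by (auto simp: compatible_partitions_def)
    finally show ?thesis
      using finQ by (simp add: sum.If_cases Int_def flip: of_nat_prod)
  qed
  have conn: "join_part ?U p (W ` A) = {?U} \<longleftrightarrow>
      (\<forall>T\<subseteq>A. T \<noteq> {} \<longrightarrow> separated (touched W A ` p) T \<longrightarrow> T = A)" if "p \<in> ?Q" for p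
  proof -
    have "partition_on ?U p" using that by (auto simp: invariant_partitions_def)
    moreover have "?U \<noteq> {}" using A W by auto
    ultimately show ?thesis
      using join_part_eq_one_block_iff[of ?U p "W ` A"] separated_touched_iff[OF disj, of p] W QU[OF that] by auto
  qed
  have "(\<Sum>\<pi>\<in>?P. part_moebius \<pi> * (\<Prod>B\<in>\<pi>. of_nat (card (invariant_partitions bal g (\<Union>j\<in>B. W j)))))
    = (\<Sum>\<pi>\<in>?P. \<Sum>p\<in>?Q. if \<pi> \<in> compatible_partitions (touched W A ` p) A then part_moebius \<pi> else 0)"
    by (intro sum.cong refl) (simp add: term_eq sum_distrib_left if_distrib cong: if_cong)
  also have "\<dots> = (\<Sum>p\<in>?Q. \<Sum>\<pi>\<in>?P. if \<pi> \<in> compatible_partitions (touched W A ` p) A then part_moebius \<pi> else 0)"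
    by (rule sum.swap)
  also have "\<dots> = (\<Sum>p\<in>?Q. \<Sum>\<pi>\<in>compatible_partitions (touched W A ` p) A. part_moebius \<pi>)"
  proof (rule sum.cong[OF refl])
    fix p
    have "?P \<inter> compatible_partitions (touched W A ` p) A = compatible_partitions (touched W A ` p) A"
      by (auto simp: compatible_partitions_def)
    then show "(\<Sum>\<pi>\<in>?P. if \<pi> \<in> compatible_partitions (touched W A ` p) A then part_moebius \<pi> else 0)
       = (\<Sum>\<pi>\<in>compatible_partitions (touched W A ` p) A. part_moebius \<pi>)"
      using finP by (simp add: sum.inter_restrict[symmetric])
  qed
  also have "\<dots> = (\<Sum>p\<in>?Q. if join_part ?U p (W ` A) = {?U} then 1 else 0)"
  proof (rule sum.cong[OF refl])
    fix p assume "p \<in> ?Q"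
    then show "(\<Sum>\<pi>\<in>compatible_partitions (touched W A ` p) A. part_moebius \<pi>)
      = (if join_part ?U p (W ` A) = {?U} then 1 else 0)"
      unfolding conn[OF \<open>p \<in> ?Q\<close>] by (intro sum_part_moebius_compatible A) (auto simp: touched_def)
  qed
  also have "\<dots> = of_nat (card {p \<in> ?Q. join_part ?U p (W ` A) = {?U}})"
    using finQ by (simp add: sum.If_cases Int_def)
  finally show ?thesis .
qed

section \<open>Traces and moments\<close>

text \<open>One formula covers a single trace and a product of traces: \<open>U\<close> is then a
  union of cycles of \<open>g\<close>, and \<open>\<epsilon>\<close> is the concatenated
  string.\<close>

definition cyclic_sum :: "nat \<Rightarrow> (nat \<Rightarrow> nat \<Rightarrow> complex) \<Rightarrow> sym list \<Rightarrow> (nat \<Rightarrow> nat) \<Rightarrow> nat set \<Rightarrow> complex" where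
  "cyclic_sum n V \<epsilon> g U = (\<Sum>i\<in>U \<rightarrow>\<^sub>E {0..<n}. \<Prod>x\<in>U. ent (\<epsilon> ! x) V (i x) (i (g x)))"

text \<open>As \<open>g\<close> preserves both parts, no factor couples an index in \<open>A\<close>
  with one in \<open>C\<close>, and a function on the disjoint union is a pair of
  restrictions.\<close>

lemma cyclic_sum_Un:
  assumes A: "finite A" "g ` A \<subseteq> A" and C: "finite C" "g ` C \<subseteq> C" and disj: "A \<inter> C = {}"
  shows "cyclic_sum n V \<epsilon> g (A \<union> C) = cyclic_sum n V \<epsilon> g A * cyclic_sum n V \<epsilon> g C"
proof -
  let ?t = "\<lambda>U i. \<Prod>x\<in>U. ent (\<epsilon> ! x) V (i x) (i (g x))"
  have cong: "?t U i = ?t U j" if "\<And>x. x \<in> U \<Longrightarrow> i x = j x" "g ` U \<subseteq> U" for U i j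
    using that by (intro prod.cong refl) (simp add: image_subset_iff)
  have "cyclic_sum n V \<epsilon> g (A \<union> C)
      = (\<Sum>(i, j)\<in>(A \<rightarrow>\<^sub>E {0..<n}) \<times> (C \<rightarrow>\<^sub>E {0..<n}). ?t A i * ?t C j)"
    unfolding cyclic_sum_def
  proof (rule sum.reindex_bij_witness[of _ "\<lambda>(i, j). \<lambda>x\<in>A \<union> C. if x \<in> A then i x else j x"
        "\<lambda>i. (restrict i A, restrict i C)"], goal_cases)
    case (1 i)
    then show ?case by (auto simp: fun_eq_iff PiE_def extensional_def)
  next
    case (2 i)
    then show ?case by (auto simp: PiE_def Pi_def)
  next
    case (3 x)
    obtain i j where x: "x = (i, j)" "i \<in> A \<rightarrow>\<^sub>E {0..<n}" "j \<in> C \<rightarrow>\<^sub>E {0..<n}" using 3 by auto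
    have "y \<notin> A" if "y \<in> C" for y using disj that by blast
    then show ?case using x by (auto simp: fun_eq_iff PiE_def extensional_def)
  next
    case (4 x)
    then show ?case by (auto simp: PiE_def Pi_def)
  next
    case (5 i)
    have "?t A i = ?t A (restrict i A)" "?t C i = ?t C (restrict i C)"
      using cong[of A i "restrict i A"] cong[of C i "restrict i C"] A(2) C(2) by simp_all
    then show ?case using A C disj by (simp add: prod.union_disjoint)
  qed
  also have "\<dots> = cyclic_sum n V \<epsilon> g A * cyclic_sum n V \<epsilon> g C"
    unfolding cyclic_sum_def by (simp add: sum_product sum.cartesian_product)
  finally show ?thesis .
qed

lemma cyclic_sum_UN:
  assumes "finite B" and "disjoint_family_on W B" and "\<And>j. j \<in> B \<Longrightarrow> finite (W j) \<and> g ` W j \<subseteq> W j"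
  shows "cyclic_sum n V \<epsilon> g (\<Union>j\<in>B. W j) = (\<Prod>j\<in>B. cyclic_sum n V \<epsilon> g (W j))"
  using assms
proof (induction rule: finite_induct)
  case empty
  show ?case by (simp add: cyclic_sum_def)
next
  case (insert j B)
  have "cyclic_sum n V \<epsilon> g (W j \<union> (\<Union>j\<in>B. W j)) = cyclic_sum n V \<epsilon> g (W j) * cyclic_sum n V \<epsilon> g (\<Union>j\<in>B. W j)"
  proof (rule cyclic_sum_Un)
    show "W j \<inter> (\<Union>j\<in>B. W j) = {}"
      using insert by (auto simp: disjoint_family_on_def)
    show "g ` (\<Union>j\<in>B. W j) \<subseteq> (\<Union>j\<in>B. W j)"
      using insert.prems(2) by blast
  qed (use insert in auto)
  moreover have "disjoint_family_on W B"
    using insert.prems(1) by (auto simp: disjoint_family_on_def)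
  ultimately show ?case using insert by simp
qed

section \<open>Positions of the traces in the concatenated string\<close>

definition positions :: "nat list \<Rightarrow> nat \<Rightarrow> nat set" where
  "positions ks j = {sum_list (take j ks)..<sum_list (take (Suc j) ks)}"

lemma sum_list_take_mono: "i \<le> j \<Longrightarrow> sum_list (take i ks) \<le> sum_list (take j (ks :: nat list))"
  by (metis le_add1 le_Suc_ex sum_list_append take_add)

lemma sum_list_take_Suc: "j < length ks \<Longrightarrow> sum_list (take (Suc j) ks) = sum_list (take j ks) + (ks :: nat list) ! j"
  by (simp add: take_Suc_conv_app_nth)

lemma blk_positions:
  assumes "x \<in> positions ks j"
  shows "blk ks x = j"
  unfolding blk_def
proof (rule Least_equality)
  show "x < sum_list (take (Suc j) ks)" using assms by (simp add: positions_def)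
  fix l assume "x < sum_list (take (Suc l) ks)"
  then show "j \<le> l"
    using sum_list_take_mono[of "Suc l" j ks] assms by (force simp: positions_def not_less_eq_eq)
qed

text \<open>Relative to the start of its trace, the trace permutation is the cyclic successor; the
  modulus acts only at the last position, where \<open>Suc l = ks ! j\<close>.\<close>

lemma trace_perm_positions:
  assumes j: "j < length ks" and l: "l < ks ! j"
  shows "trace_perm ks (sum_list (take j ks) + l) = sum_list (take j ks) + Suc l mod ks ! j"
proof -
  have "blk ks (sum_list (take j ks) + l) = j"
    using l by (intro blk_positions) (simp add: positions_def sum_list_take_Suc[OF j])
  then show ?thesis
    using l by (cases "Suc l = ks ! j") (auto simp: trace_perm_def sum_list_take_Suc[OF j])
qed

lemma positions_image:
  assumes "j < length ks"
  shows "positions ks j = (\<lambda>l. sum_list (take j ks) + l) ` {0..<ks ! j}"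
  unfolding positions_def sum_list_take_Suc[OF assms]
  by (simp add: add.commute[of _ "sum_list (take j ks)"])

lemma trace_perm_image_positions:
  assumes j: "j < length ks"
  shows "trace_perm ks ` positions ks j = positions ks j"
proof -
  have "(\<lambda>l. Suc l mod k) ` {0..<k} = {0..<k}" for k :: nat
  proof (cases "k = 0")
    case False
    have "x \<in> (\<lambda>l. Suc l mod k) ` {0..<k}" if "x < k" for x
    proof (cases x)
      case 0
      then show ?thesis using False by (intro image_eqI[of _ _ "k - 1"]) auto
    next
      case (Suc y)
      then show ?thesis using that by (intro image_eqI[of _ _ y]) auto
    qed
    then show ?thesis using False by auto
  qed simp
  then have "(\<lambda>l. sum_list (take j ks) + l) ` (\<lambda>l. Suc l mod ks ! j) ` {0..<ks ! j} = positions ks j"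
    by (simp add: positions_image[OF j])
  moreover have "trace_perm ks ` positions ks j
     = (\<lambda>l. sum_list (take j ks) + l) ` (\<lambda>l. Suc l mod ks ! j) ` {0..<ks ! j}"
    unfolding positions_image[OF j] image_image
    by (intro image_cong refl trace_perm_positions j) simp
  ultimately show ?thesis by simp
qed

lemma disjoint_family_positions: "disjoint_family_on (positions ks) A"
  unfolding disjoint_family_on_def using blk_positions by blast

lemma UN_positions: "(\<Union>j\<in>{0..<length ks}. positions ks j) = {0..<sum_list ks}"
proof -
  have "(\<Union>j\<in>{0..<m}. positions ks j) = {0..<sum_list (take m ks)}" for m
  proof (induction m)
    case (Suc m)
    have "{0..<sum_list (take m ks)} \<union> positions ks m = {0..<sum_list (take (Suc m) ks)}"
      using sum_list_take_mono[of m "Suc m" ks] by (auto simp: positions_def)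
    then show ?case using Suc by (simp add: atLeast0_lessThan_Suc Un_commute)
  qed simp
  from this[of "length ks"] show ?thesis by simp
qed

lemma concat_nth_positions:
  assumes "j < length xs" "l < length (xs ! j)"
  shows "concat xs ! (sum_list (take j (map length xs)) + l) = xs ! j ! l"
  using assms
proof (induction xs arbitrary: j)
  case (Cons x xs)
  then show ?case by (cases j) (auto simp: nth_append)
qed simp

text \<open>Shifting by the offset of trace \<open>j\<close> turns the successor modulo its length
  into \<open>trace_perm\<close>, so all traces use one common string and one permutation.\<close>

lemma trace_str_eq_cyclic_sum:
  assumes j: "j < length xs"
  shows "trace_str n V (xs ! j)
    = cyclic_sum n V (concat xs) (trace_perm (map length xs)) (positions (map length xs) j)"
proof -
  let ?k = "length (xs ! j)" and ?o = "sum_list (take j (map length xs))"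
  let ?g = "trace_perm (map length xs)"
  have pos: "positions (map length xs) j = (\<lambda>l. ?o + l) ` {0..<?k}"
    using positions_image[of j "map length xs"] j by simp
  have memb: "x \<in> positions (map length xs) j \<longleftrightarrow> ?o \<le> x \<and> x - ?o < ?k" for x
    unfolding pos by (auto simp: image_iff intro!: bexI[of _ "x - ?o"])
  have g: "?g (?o + l) = ?o + Suc l mod ?k" if "l < ?k" for l
    using trace_perm_positions[of j "map length xs" l] j that by simp
  show ?thesis
    unfolding trace_str_def cyclic_sum_def
  proof (rule sum.reindex_bij_witness[of _ "\<lambda>i. \<lambda>l\<in>{0..<?k}. i (?o + l)"
        "\<lambda>i. \<lambda>x\<in>positions (map length xs) j. i (x - ?o)"], goal_cases)
    case (1 i)
    then show ?case by (auto simp: fun_eq_iff memb PiE_def extensional_def)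
  next
    case (2 i)
    then show ?case by (auto simp: memb PiE_def Pi_def)
  next
    case (3 i)
    then show ?case by (auto simp: fun_eq_iff memb PiE_def extensional_def)
  next
    case (4 i)
    then show ?case by (auto simp: memb PiE_def Pi_def)
  next
    case (5 i)
    let ?i = "\<lambda>x\<in>positions (map length xs) j. i (x - ?o)"
    have "(\<Prod>x\<in>positions (map length xs) j. ent (concat xs ! x) V (?i x) (?i (?g x)))
      = (\<Prod>l<?k. ent (concat xs ! (?o + l)) V (?i (?o + l)) (?i (?g (?o + l))))"
      by (subst (1) pos, subst prod.reindex) (auto simp: lessThan_atLeast0)
    also have "\<dots> = (\<Prod>l<?k. ent (xs ! j ! l) V (i l) (i (Suc l mod ?k)))"
    proof (intro prod.cong refl)
      fix l assume "l \<in> {..<?k}"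
      then have "l < ?k" "Suc l mod ?k < ?k" by (auto intro!: mod_less_divisor)
      then show "ent (concat xs ! (?o + l)) V (?i (?o + l)) (?i (?g (?o + l)))
          = ent (xs ! j ! l) V (i l) (i (Suc l mod ?k))"
        using j by (simp add: g memb concat_nth_positions)
    qed
    finally show ?case .
  qed
qed

section \<open>Moments of sublists of traces\<close>

lemma prod_nths:
  fixes f :: "'a \<Rightarrow> 'b :: comm_monoid_mult"
  assumes "B \<subseteq> {0..<length xs}"
  shows "(\<Prod>j<length (nths xs B). f (nths xs B ! j)) = (\<Prod>j\<in>B. f (xs ! j))"
proof -
  have "prod_list (map f (nths xs B)) = (\<Prod>j\<in>B \<inter> {0..<length xs}. f (xs ! j))" for B
  proof (induction xs rule: rev_induct)
    case (snoc x xs)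
    have "(\<Prod>j\<in>B \<inter> {0..<length xs}. f ((xs @ [x]) ! j)) = (\<Prod>j\<in>B \<inter> {0..<length xs}. f (xs ! j))"
      by (intro prod.cong refl) (auto simp: nth_append)
    moreover have "B \<inter> {0..<length (xs @ [x])}
       = (if length xs \<in> B then insert (length xs) (B \<inter> {0..<length xs}) else B \<inter> {0..<length xs})"
      by (auto simp: less_Suc_eq)
    ultimately show ?case using snoc by (simp add: nths_append nths_singleton mult.commute)
  qed simp
  then have "prod_list (map f (nths xs B)) = (\<Prod>j\<in>B. f (xs ! j))"
    using assms by (simp add: Int_absorb2)
  then show ?thesis by (simp add: prod.list_conv_set_nth lessThan_atLeast0)
qed

text \<open>The moment is exact as soon as \<open>n\<close> reaches the total length: the traces in
  \<open>B\<close> form one cyclic sum over \<open>U\<close>, every kernel on \<open>U\<close> fits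
  into \<open>n\<close> values, and the factor \<open>fact n\<close> cancels. Sublists keep their
  positions in the full string, so the counts for different \<open>B\<close> can be multiplied and
  compared.\<close>

lemma moment_nths:
  assumes s: "s \<noteq> 0" and B: "B \<subseteq> {0..<length xs}" and n: "length (concat xs) \<le> n"
  defines "U \<equiv> \<Union>j\<in>B. positions (map length xs) j"
  shows "moment s n (nths xs B)
    = of_nat (card (invariant_partitions (balanced_block s (concat xs)) (trace_perm (map length xs)) U))"
proof -
  let ?g = "trace_perm (map length xs)"
  have finB: "finite B" using B by (rule finite_subset) simp
  have gW: "?g ` positions (map length xs) j = positions (map length xs) j" if "j \<in> B" for j
    using that B by (intro trace_perm_image_positions) auto
  have finU: "finite U" using finB by (simp add: U_def positions_def)
  have gU: "?g ` U = U" using gW by (simp add: U_def image_UN)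
  have bij: "bij_betw ?g U U" using finU gU by (simp add: bij_betw_def finite_surj_inj)
  have "U \<subseteq> (\<Union>j\<in>{0..<length (map length xs)}. positions (map length xs) j)"
    using B unfolding U_def by auto
  then have "U \<subseteq> {0..<length (concat xs)}" by (simp only: UN_positions length_concat)
  then have "U \<subseteq> {0..<n}" using n by (auto dest: subsetD)
  then have le: "card U \<le> card {0..<n}" by (intro card_mono) auto
  have "moment s n (nths xs B) = haar_exp s n (\<lambda>V. \<Prod>j\<in>B. trace_str n V (xs ! j))"
    unfolding moment_def by (simp add: prod_nths[OF B])
  also have "(\<lambda>V. \<Prod>j\<in>B. trace_str n V (xs ! j)) = (\<lambda>V. cyclic_sum n V (concat xs) ?g U)"
  proof
    fix V
    have "(\<Prod>j\<in>B. trace_str n V (xs ! j)) = (\<Prod>j\<in>B. cyclic_sum n V (concat xs) ?g (positions (map length xs) j))"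
      using B by (intro prod.cong refl trace_str_eq_cyclic_sum) auto
    also have "\<dots> = cyclic_sum n V (concat xs) ?g U"
      unfolding U_def using gW finB disjoint_family_positions
      by (intro cyclic_sum_UN[symmetric]) (simp_all, simp add: positions_def)
    finally show "(\<Prod>j\<in>B. trace_str n V (xs ! j)) = cyclic_sum n V (concat xs) ?g U" .
  qed
  also have "haar_exp s n (\<lambda>V. cyclic_sum n V (concat xs) ?g U)
     = of_nat (fact n * card (invariant_partitions (balanced_block s (concat xs)) ?g U)) / of_nat (fact n)"
    using haar_exp_sum_entries[OF s finU, of ?g n "concat xs"] gU
      sum_card_intertwiners[OF finU _ bij le, of "balanced_block s (concat xs)"]
    by (simp add: cyclic_sum_def balanced_block_empty)
  finally show ?thesis by simp
qed

lemma tendsto_moment_nths: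
  assumes "s \<noteq> 0" and "B \<subseteq> {0..<length xs}"
  shows "(\<lambda>n. moment s n (nths xs B)) \<longlonglongrightarrow> of_nat (card (invariant_partitions
    (balanced_block s (concat xs)) (trace_perm (map length xs)) (\<Union>j\<in>B. positions (map length xs) j)))"
  using moment_nths[OF assms]
  by (intro tendsto_eventually) (auto simp: eventually_at_top_linorder)

section \<open>Cumulants\<close>

theorem theorem8p3:
  fixes s :: enat and \<epsilon>s :: "sym list list"
  assumes "s \<ge> 2"
    and "\<epsilon>s \<noteq> []"
    and "\<forall>\<epsilon>\<in>set \<epsilon>s. \<epsilon> \<noteq> []"
  shows "(\<forall>xs. (\<forall>\<epsilon>\<in>set xs. \<epsilon> \<noteq> []) \<longrightarrow> convergent (\<lambda>n. moment s n xs))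
       \<and> cumulant (\<lambda>xs. lim (\<lambda>n. moment s n xs)) \<epsilon>s
         = of_nat (card {p \<in> P_s s (concat \<epsilon>s).
               join_part {0..<length (concat \<epsilon>s)} p (trace_part (map length \<epsilon>s))
                 = {{0..<length (concat \<epsilon>s)}}
             \<and> (\<lambda>B. trace_perm (map length \<epsilon>s) ` B) ` p = p})"
proof
  have s: "s \<noteq> 0" using assms(1) by auto
  show "\<forall>xs. (\<forall>\<epsilon>\<in>set xs. \<epsilon> \<noteq> []) \<longrightarrow> convergent (\<lambda>n. moment s n xs)"
  proof (intro allI impI)
    fix xs :: "sym list list"
    \<comment> \<open>Convergence of an arbitrary moment is the case of the full index set.\<close>
    have "nths xs {0..<length xs} = xs" by (simp add: nths_all)
    then show "convergent (\<lambda>n. moment s n xs)"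
      using tendsto_moment_nths[OF s, of "{0..<length xs}" xs] by (auto intro: convergentI)
  qed
  let ?ks = "map length \<epsilon>s"
  let ?g = "trace_perm ?ks" and ?bal = "balanced_block s (concat \<epsilon>s)"
  let ?A = "{0..<length \<epsilon>s}" and ?U = "{0..<length (concat \<epsilon>s)}"
  have UN: "(\<Union>j\<in>?A. positions ?ks j) = ?U"
    using UN_positions[of ?ks] by (simp add: length_concat)
  have part: "positions ?ks ` ?A = trace_part ?ks"
    by (auto simp: trace_part_def positions_def)
  have UN_part: "\<Union>(trace_part ?ks) = ?U" using UN by (simp only: part)
  have UN_part: "\<Union>(trace_part ?ks) = ?U" using UN by (simp only: part)
  have UN_part: "\<Union>(trace_part ?ks) = ?U" using UN by (simp only: part)
  \<comment> \<open>Nonempty strings give nonempty position sets, as required for connectedness on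
    traces and on positions to agree.\<close>
  have W: "finite (positions ?ks j) \<and> positions ?ks j \<noteq> {} \<and> ?g ` positions ?ks j = positions ?ks j"
    if "j \<in> ?A" for j
    using that assms(3) trace_perm_image_positions[of j ?ks]
    by (auto simp: positions_image nth_mem)
  \<comment> \<open>\<open>?g\<close> maps each trace onto itself, hence the finite set
    \<open>?U\<close> onto itself, and is therefore injective there.\<close>
  have inj: "inj_on ?g ?U"
  proof -
    have "?g ` ?U = ?U" unfolding UN[symmetric] image_UN using W by simp
    then show ?thesis by (simp add: finite_surj_inj eq_card_imp_inj_on)
  qed
  have "cumulant (\<lambda>xs. lim (\<lambda>n. moment s n xs)) \<epsilon>s
     = (\<Sum>\<pi> | partition_on ?A \<pi>. part_moebius \<pi> *
          (\<Prod>B\<in>\<pi>. of_nat (card (invariant_partitions ?bal ?g (\<Union>j\<in>B. positions ?ks j)))))"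
    unfolding cumulant_def part_moebius_def
  proof (intro sum.cong refl arg_cong2[where f = times] prod.cong)
    fix \<pi> B assume "\<pi> \<in> {\<pi>. partition_on ?A \<pi>}" "B \<in> \<pi>"
    then have "B \<subseteq> ?A" by (auto simp: partition_on_def)
    then show "lim (\<lambda>n. moment s n (nths \<epsilon>s B))
       = of_nat (card (invariant_partitions ?bal ?g (\<Union>j\<in>B. positions ?ks j)))"
      by (intro limI tendsto_moment_nths s)
  qed
  also have "\<dots> = of_nat (card {p \<in> invariant_partitions ?bal ?g ?U. join_part ?U p (trace_part ?ks) = {?U}})"
    using sum_part_moebius_card_invariant[of ?A "positions ?ks" ?g ?bal] W assms(2) disjoint_family_positions
    unfolding part UN_part by simp
  also have "{p \<in> invariant_partitions ?bal ?g ?U. join_part ?U p (trace_part ?ks) = {?U}}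
     = {p \<in> P_s s (concat \<epsilon>s). join_part ?U p (trace_part ?ks) = {?U} \<and> (\<lambda>B. ?g ` B) ` p = p}"
  \<comment> \<open>Balance is the same condition on both sides, and for a partition
    \<open>p\<close> of \<open>?U\<close> blockwise invariance agrees with \<open>p\<close> being
    equal to its image.\<close>
  proof (rule Collect_cong)
    fix p
    show "p \<in> invariant_partitions ?bal ?g ?U \<and> join_part ?U p (trace_part ?ks) = {?U} \<longleftrightarrow>
      p \<in> P_s s (concat \<epsilon>s) \<and> join_part ?U p (trace_part ?ks) = {?U} \<and> (\<lambda>B. ?g ` B) ` p = p"
    proof (cases "partition_on ?U p")
      case True
      show ?thesis
        unfolding image_blocks_eq_iff[OF finite_atLeastLessThan inj True]
        using True by (auto simp: invariant_partitions_def P_s_def)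
    qed (simp add: invariant_partitions_def P_s_def)
  qed
  finally show "cumulant (\<lambda>xs. lim (\<lambda>n. moment s n xs)) \<epsilon>s
         = of_nat (card {p \<in> P_s s (concat \<epsilon>s).
               join_part ?U p (trace_part ?ks) = {?U} \<and> (\<lambda>B. ?g ` B) ` p = p})" .
qed

end
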